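(* Let $\lambda\in\mathfrak h^*$ with $\lambda(c_1)=k_1>0$ and $\lambda(c_2)=0$. Let $M(\lambda)^+=\{v\in M(\lambda)\mid\mathfrak T_+v=0\}$ and $M=\bigoplus_{\eta\in\mathcal Q_{1+}}M(\lambda)_{\lambda-\eta}$. Then $M(\lambda)^+\subset M$.
   Context: All over $\mathbb C$; $\mathbb Z_+$ = nonnegative integers. $\mathfrak{sl}_2$ has standard basis $e,f,\alpha^\vee$ with $[e,f]=\alpha^\vee$, $[\alpha^\vee,e]=2e$, $[\alpha^\vee,f]=-2f$ and invariant form with $(e|f)=1$, $(\alpha^\vee|\alpha^\vee)=2$. The toroidal Lie algebra is $\mathfrak T=\mathfrak{sl}_2\otimes\mathbb C[t_1^{\pm1},t_2^{\pm1}]\oplus\mathbb Cc_1\oplus\mathbb Cc_2\oplus\mathbb Cd_1\oplus\mathbb Cd_2$. Writing $x(m,n)=x\otimes t_1^mt_2^n$, the brackets are $[x(r_1,r_2),y(s_1,s_2)]=[x,y](r_1+s_1,r_2+s_2)+(x|y)\delta_{r_1,-s_1}\delta_{r_2,-s_2}(r_1c_1+r_2c_2)$, $c_1,c_2$ central, $[d_i,x(r_1,r_2)]=r_i\,x(r_1,r_2)$, $[d_1,d_2]=0$. Cartan subalgebra: $\mathfrak h=\mathbb C\alpha^\vee\oplus\mathbb Cc_1\oplus\mathbb Cc_2\oplus\mathbb Cd_1\oplus\mathbb Cd_2$ ($\alpha^\vee=\alpha^\vee(0,0)$). In $\mathfrak h^*$: $\alpha(\alpha^\vee)=2$, $\alpha(c_j)=\alpha(d_j)=0$;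 $\delta_i(d_j)=\delta_{ij}$, $\delta_i(c_j)=\delta_i(\alpha^\vee)=0$. Put $\alpha_1=\alpha$, $\alpha_0=\delta_1-\alpha$, and $\mathcal Q_{1+}=\mathbb Z_+\alpha_0+\mathbb Z_+\alpha_1$. Triangular decomposition $\mathfrak T=\mathfrak T_+\oplus\mathfrak h\oplus\mathfrak T_-$: $\mathfrak T_+$ is spanned by $e(m,0)$ $(m\ge 0)$, $f(m,0)$ and $\alpha^\vee(m,0)$ $(m\ge1)$, and all $x(m,n)$ with $x\in\mathfrak{sl}_2$, $m\in\mathbb Z$, $n\ge1$; $\mathfrak T_-$ is spanned by $f(-m,0)$ $(m\ge0)$, $e(-m,0)$ and $\alpha^\vee(-m,0)$ $(m\ge1)$, and all $x(m,-n)$ with $x\in\mathfrak{sl}_2$, $m\in\mathbb Z$, $n\ge1$. Verma module: $M(\lambda)=U(\mathfrak T)\otimes_{U(\mathfrak T_+\oplus\mathfrak h)}\mathbb C1_\lambda$, where $\mathfrak T_+$ acts by $0$ on $1_\lambda$ and $h\in\mathfrak h$ acts by $\lambda(h)$; $M(\lambda)_\mu$ denotes the $\mathfrak h$-weight space of weight $\mu\in\mathfrak h^*$. *)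

theory Defs
  imports Complex_Main "HOL-Library.Poly_Mapping" "HOL-Library.Set_Algebras"
begin

section \<open>Complex Lie algebras\<close>

class complex_lie_algebra = ab_group_add +
  fixes scaleC :: "complex \<Rightarrow> 'a \<Rightarrow> 'a"  (infixr \<open>*\<^sub>C\<close> 75)
    and lie :: "'a \<Rightarrow> 'a \<Rightarrow> 'a"
  assumes scaleC_add_right: "c *\<^sub>C (x + y) = c *\<^sub>C x + c *\<^sub>C y"
    and scaleC_add_left: "(c + d) *\<^sub>C x = c *\<^sub>C x + d *\<^sub>C x"
    and scaleC_scaleC: "c *\<^sub>C (d *\<^sub>C x) = (c * d) *\<^sub>C x"
    and scaleC_one: "1 *\<^sub>C x = x"
    and lie_add_left: "lie (x + y) z = lie x z + lie y z"
    and lie_add_right: "lie x (y + z) = lie x y + lie x z"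
    and lie_scaleC_left: "lie (c *\<^sub>C x) y = c *\<^sub>C lie x y"
    and lie_scaleC_right: "lie x (c *\<^sub>C y) = c *\<^sub>C lie x y"
    and lie_self: "lie x x = 0"
    and jacobi: "lie x (lie y z) + lie y (lie z x) + lie z (lie x y) = 0"

global_interpretation lie_vs: vector_space "scaleC :: complex \<Rightarrow> 'a \<Rightarrow> 'a::complex_lie_algebra"
  by standard (simp_all add: scaleC_add_right scaleC_add_left scaleC_scaleC scaleC_one)


section \<open>The universal enveloping algebra\<close>

text \<open>
  Lists form the free monoid, so \<open>'g list \<Rightarrow>\<^sub>0 complex\<close> with the convolution product of
  \<open>HOL-Library.Poly_Mapping\<close> is the free unital associative complex algebra on the set \<open>'g\<close>.
\<close>

instantiation list :: (type) monoid_add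
begin
definition zero_list :: "'a list" where "zero_list = []"
definition plus_list :: "'a list \<Rightarrow> 'a list \<Rightarrow> 'a list" where "plus_list xs ys = xs @ ys"
instance by standard (simp_all add: zero_list_def plus_list_def)
end

abbreviation free_gen :: "'g \<Rightarrow> ('g list \<Rightarrow>\<^sub>0 complex)" where
  "free_gen x \<equiv> Poly_Mapping.single [x] 1"

abbreviation free_const :: "complex \<Rightarrow> ('g list \<Rightarrow>\<^sub>0 complex)" where
  "free_const c \<equiv> Poly_Mapping.single 0 c"

text \<open>
  The relations of the first two kinds cut the free algebra on the set \<open>'g\<close> down to the tensor
  algebra of the vector space \<open>'g\<close>; the third kind gives the enveloping algebra.
\<close>

inductive_set uea_relations :: "('g::complex_lie_algebra list \<Rightarrow>\<^sub>0 complex) set" where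
  rel_add: "free_gen (x + y) - free_gen x - free_gen y \<in> uea_relations"
| rel_scale: "free_gen (c *\<^sub>C x) - free_const c * free_gen x \<in> uea_relations"
| rel_lie: "free_gen x * free_gen y - free_gen y * free_gen x - free_gen (lie x y) \<in> uea_relations"

inductive_set uea_ideal :: "('g::complex_lie_algebra list \<Rightarrow>\<^sub>0 complex) set" where
  ideal_gen: "r \<in> uea_relations \<Longrightarrow> p * r * q \<in> uea_ideal"
| ideal_add: "p \<in> uea_ideal \<Longrightarrow> q \<in> uea_ideal \<Longrightarrow> p + q \<in> uea_ideal"

lemma ideal_zero: "0 \<in> uea_ideal"
  using ideal_gen[OF rel_add, of 0 _ _ 0] by simp

lemma ideal_mult: "p \<in> uea_ideal \<Longrightarrow> a * p * b \<in> uea_ideal"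
proof (induction rule: uea_ideal.induct)
  case (ideal_gen r p q)
  then show ?case
    using uea_ideal.ideal_gen[of r "a * p" "q * b"] by (simp add: mult.assoc)
next
  case (ideal_add p q)
  then show ?case
    using uea_ideal.ideal_add by (simp add: distrib_left distrib_right)
qed

lemma ideal_uminus: "p \<in> uea_ideal \<Longrightarrow> - p \<in> uea_ideal"
  using ideal_mult[of p "-1" 1] by simp

lemma ideal_diff: "p \<in> uea_ideal \<Longrightarrow> q \<in> uea_ideal \<Longrightarrow> p - q \<in> uea_ideal"
  using ideal_add[of p "-q"] ideal_uminus[of q] by simp

lemma lookup_mult_Nil:
  fixes p q :: "'g list \<Rightarrow>\<^sub>0 complex"
  shows "Poly_Mapping.lookup (p * q) [] = Poly_Mapping.lookup p [] * Poly_Mapping.lookup q []"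
proof -
  have "([] = l + m) \<longleftrightarrow> m = [] \<and> l = []" for l m :: "'g list"
    by (auto simp: plus_list_def)
  moreover have "(\<Sum>m. Poly_Mapping.lookup q m when m = [] \<and> l = []) = (Poly_Mapping.lookup q [] when l = [])" for l :: "'g list"
    by (cases "l = []") simp_all
  ultimately show ?thesis
    by (simp add: lookup_mult mult_when)
qed

lemma uea_ideal_lookup_Nil: "p \<in> uea_ideal \<Longrightarrow> Poly_Mapping.lookup p [] = 0"
proof (induction rule: uea_ideal.induct)
  case (ideal_gen r p q)
  then have "Poly_Mapping.lookup r [] = 0"
    by (induction rule: uea_relations.induct)
      (simp_all add: lookup_minus lookup_mult_Nil lookup_single)
  then show ?case by (simp add: lookup_mult_Nil)
qed (simp add: lookup_add)

quotient_type (overloaded) 'g uea = "'g::complex_lie_algebra list \<Rightarrow>\<^sub>0 complex" / "\<lambda>p q. p - q \<in> uea_ideal"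
proof (rule equivpI)
  show "reflp (\<lambda>p q. p - q \<in> uea_ideal)"
    by (simp add: reflp_def ideal_zero)
  show "symp (\<lambda>p q. p - q \<in> uea_ideal)"
    using ideal_uminus by (fastforce simp: symp_def)
  show "transp (\<lambda>p q. p - q \<in> uea_ideal)"
    using ideal_add by (fastforce simp: transp_def)
qed

instantiation uea :: (complex_lie_algebra) ring_1
begin

lift_definition zero_uea :: "'a uea" is 0 .
lift_definition one_uea :: "'a uea" is 1 .
lift_definition plus_uea :: "'a uea \<Rightarrow> 'a uea \<Rightarrow> 'a uea" is "(+)"
  using ideal_add by (fastforce simp: algebra_simps)
lift_definition uminus_uea :: "'a uea \<Rightarrow> 'a uea" is uminus
  using ideal_uminus by fastforce
lift_definition minus_uea :: "'a uea \<Rightarrow> 'a uea \<Rightarrow> 'a uea" is "(-)"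
  using ideal_diff by (fastforce simp: algebra_simps)
lift_definition times_uea :: "'a uea \<Rightarrow> 'a uea \<Rightarrow> 'a uea" is "(*)"
proof -
  fix p p' q q' :: "'a list \<Rightarrow>\<^sub>0 complex"
  assume "p - p' \<in> uea_ideal" "q - q' \<in> uea_ideal"
  then have "1 * (p - p') * q + p' * (q - q') * 1 \<in> uea_ideal"
    by (intro ideal_add ideal_mult)
  then show "p * q - p' * q' \<in> uea_ideal"
    by (simp add: algebra_simps)
qed

instance
proof
  fix u v w :: "'a uea"
  show "u + v + w = u + (v + w)" by transfer (simp add: add.assoc ideal_zero)
  show "u + v = v + u" by transfer (simp add: add.commute ideal_zero)
  show "0 + u = u" by transfer (simp add: ideal_zero)
  show "- u + u = 0" by transfer (simp add: ideal_zero)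
  show "u - v = u + - v" by transfer (simp add: ideal_zero)
  show "u * v * w = u * (v * w)" by transfer (simp add: mult.assoc ideal_zero)
  show "1 * u = u" by transfer (simp add: ideal_zero)
  show "u * 1 = u" by transfer (simp add: ideal_zero)
  show "(u + v) * w = u * w + v * w" by transfer (simp add: distrib_right ideal_zero)
  show "u * (v + w) = u * v + u * w" by transfer (simp add: distrib_left ideal_zero)
  show "(0::'a uea) \<noteq> 1"
  proof transfer
    show "0 - (1 :: 'a list \<Rightarrow>\<^sub>0 complex) \<notin> uea_ideal"
      using uea_ideal_lookup_Nil[of "0 - (1 :: 'a list \<Rightarrow>\<^sub>0 complex)"]
      by (auto simp: lookup_one zero_list_def)
  qed
qed

end

lift_definition uea_scale :: "complex \<Rightarrow> 'g::complex_lie_algebra uea \<Rightarrow> 'g uea"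
  is "\<lambda>c p. free_const c * p"
  using ideal_mult[of _ _ 1] by (fastforce simp: algebra_simps)

lift_definition uea_incl :: "'g::complex_lie_algebra \<Rightarrow> 'g uea" is free_gen .

lemma free_const_add: "free_const (c + d) = free_const c + free_const d"
  by (rule single_add)

lemma free_const_mult: "free_const (c * d) = free_const c * free_const d"
  by (simp add: mult_single)

global_interpretation uea_vs:
  vector_space "uea_scale :: complex \<Rightarrow> 'g::complex_lie_algebra uea \<Rightarrow> 'g uea"
proof
  fix c d :: complex and u v :: "'g uea"
  show "uea_scale c (u + v) = uea_scale c u + uea_scale c v"
    by transfer (simp add: distrib_left ideal_zero)
  show "uea_scale (c + d) u = uea_scale c u + uea_scale d u"
    by transfer (simp add: free_const_add distrib_right ideal_zero)
  show "uea_scale c (uea_scale d u) = uea_scale (c * d) u"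
    by transfer (simp add: free_const_mult mult.assoc ideal_zero)
  show "uea_scale 1 u = u"
    by transfer (simp add: ideal_zero)
qed

lemma free_const_commute:
  fixes p :: "'g list \<Rightarrow>\<^sub>0 complex"
  shows "p * free_const c = free_const c * p"
proof (rule poly_mapping_eqI)
  fix k :: "'g list"
  have "(\<Sum>m. Poly_Mapping.lookup (free_const c) m when k = l + m) = (c when l = k)" for l :: "'g list"
  proof -
    have "(Poly_Mapping.lookup (free_const c) m when k = l + m) = ((c when l = k) when m = 0)" for m :: "'g list"
      by (auto simp: lookup_single when_def)
    then show ?thesis
      by simp
  qed
  then have "Poly_Mapping.lookup (p * free_const c) k = Poly_Mapping.lookup p k * c"
    by (simp add: lookup_mult mult_when)
  moreover have "Poly_Mapping.lookup (free_const c * p) k = c * Poly_Mapping.lookup p k"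
    by (simp flip: mult_map_scale_conv_mult add: Poly_Mapping.map.rep_eq when_def)
  ultimately show "Poly_Mapping.lookup (p * free_const c) k = Poly_Mapping.lookup (free_const c * p) k"
    by simp
qed

lemma mult_uea_scale_right: "u * uea_scale c v = uea_scale c (u * v)"
proof transfer
  fix c and u v :: "'a list \<Rightarrow>\<^sub>0 complex"
  have "u * (free_const c * v) = free_const c * (u * v)"
    by (simp add: free_const_commute flip: mult.assoc)
  then show "u * (free_const c * v) - free_const c * (u * v) \<in> uea_ideal"
    by (simp add: ideal_zero)
qed


section \<open>The toroidal Lie algebra of type \<open>sl\<^sub>2\<close>\<close>

text \<open>
  The basis elements \<open>e\<close>, \<open>f\<close>, \<open>\<alpha>\<^sup>\<vee>\<close> of \<open>sl\<^sub>2\<close> are \<open>E\<close>, \<open>F\<close>, \<open>H\<close>; an element of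
  \<open>sl\<^sub>2\<close> is given by its coordinates.
\<close>

datatype sl2_basis = E | F | H

type_synonym sl2 = "sl2_basis \<Rightarrow> complex"

fun sl2_bracket :: "sl2_basis \<Rightarrow> sl2_basis \<Rightarrow> sl2" where
  "sl2_bracket E F = (\<lambda>_. 0)(H := 1)"
| "sl2_bracket F E = (\<lambda>_. 0)(H := -1)"
| "sl2_bracket H E = (\<lambda>_. 0)(E := 2)"
| "sl2_bracket E H = (\<lambda>_. 0)(E := -2)"
| "sl2_bracket H F = (\<lambda>_. 0)(F := -2)"
| "sl2_bracket F H = (\<lambda>_. 0)(F := 2)"
| "sl2_bracket E E = (\<lambda>_. 0)"
| "sl2_bracket F F = (\<lambda>_. 0)"
| "sl2_bracket H H = (\<lambda>_. 0)"

fun sl2_form :: "sl2_basis \<Rightarrow> sl2_basis \<Rightarrow> complex" where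
  "sl2_form E F = 1"
| "sl2_form F E = 1"
| "sl2_form H H = 2"
| "sl2_form _ _ = 0"

text \<open>\<open>Loop a m n\<close> stands for the basis element \<open>a \<otimes> t\<^sub>1\<^sup>m t\<^sub>2\<^sup>n\<close>.\<close>

datatype toroidal_basis = Loop sl2_basis int int | C1 | C2 | D1 | D2

definition loop_coords :: "sl2 \<Rightarrow> int \<Rightarrow> int \<Rightarrow> (toroidal_basis \<Rightarrow>\<^sub>0 complex)" where
  "loop_coords x m n = (\<Sum>a\<in>{E, F, H}. Poly_Mapping.single (Loop a m n) (x a))"

fun basis_bracket :: "toroidal_basis \<Rightarrow> toroidal_basis \<Rightarrow> (toroidal_basis \<Rightarrow>\<^sub>0 complex)" where
  "basis_bracket (Loop a r1 r2) (Loop b s1 s2) =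
     loop_coords (sl2_bracket a b) (r1 + s1) (r2 + s2) +
     (if r1 = - s1 \<and> r2 = - s2
      then Poly_Mapping.single C1 (sl2_form a b * of_int r1) +
           Poly_Mapping.single C2 (sl2_form a b * of_int r2)
      else 0)"
| "basis_bracket D1 (Loop a r1 r2) = Poly_Mapping.single (Loop a r1 r2) (of_int r1)"
| "basis_bracket D2 (Loop a r1 r2) = Poly_Mapping.single (Loop a r1 r2) (of_int r2)"
| "basis_bracket (Loop a r1 r2) D1 = - Poly_Mapping.single (Loop a r1 r2) (of_int r1)"
| "basis_bracket (Loop a r1 r2) D2 = - Poly_Mapping.single (Loop a r1 r2) (of_int r2)"
| "basis_bracket _ _ = 0"

definition coords_scale :: "complex \<Rightarrow> ('b \<Rightarrow>\<^sub>0 complex) \<Rightarrow> ('b \<Rightarrow>\<^sub>0 complex)" where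
  "coords_scale c p = Poly_Mapping.map ((*) c) p"

definition coords_lie ::
    "(toroidal_basis \<Rightarrow>\<^sub>0 complex) \<Rightarrow> (toroidal_basis \<Rightarrow>\<^sub>0 complex) \<Rightarrow> (toroidal_basis \<Rightarrow>\<^sub>0 complex)" where
  "coords_lie p q = (\<Sum>a\<in>Poly_Mapping.keys p. \<Sum>b\<in>Poly_Mapping.keys q.
     coords_scale (Poly_Mapping.lookup p a * Poly_Mapping.lookup q b) (basis_bracket a b))"

lemma lookup_coords_scale [simp]:
  "Poly_Mapping.lookup (coords_scale c p) k = c * Poly_Mapping.lookup p k"
  by (simp add: coords_scale_def Poly_Mapping.map.rep_eq when_def)

interpretation coords: vector_space "coords_scale :: complex \<Rightarrow> ('b \<Rightarrow>\<^sub>0 complex) \<Rightarrow> _"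
  by standard (auto intro!: poly_mapping_eqI simp: lookup_add algebra_simps)

lemma coords_lie_superset:
  assumes "finite A" "Poly_Mapping.keys p \<subseteq> A" "finite B" "Poly_Mapping.keys q \<subseteq> B"
  shows "coords_lie p q = (\<Sum>a\<in>A. \<Sum>b\<in>B.
    coords_scale (Poly_Mapping.lookup p a * Poly_Mapping.lookup q b) (basis_bracket a b))"
proof -
  have "coords_lie p q = (\<Sum>a\<in>Poly_Mapping.keys p. \<Sum>b\<in>B.
    coords_scale (Poly_Mapping.lookup p a * Poly_Mapping.lookup q b) (basis_bracket a b))"
    unfolding coords_lie_def using assms
    by (intro sum.cong sum.mono_neutral_left) (auto simp: in_keys_iff)
  also have "\<dots> = (\<Sum>a\<in>A. \<Sum>b\<in>B.
    coords_scale (Poly_Mapping.lookup p a * Poly_Mapping.lookup q b) (basis_bracket a b))"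
    using assms by (intro sum.mono_neutral_left) (auto simp: in_keys_iff)
  finally show ?thesis .
qed

lemma coords_lie_add_left: "coords_lie (p + p') q = coords_lie p q + coords_lie p' q"
proof -
  let ?A = "Poly_Mapping.keys p \<union> Poly_Mapping.keys p'"
  have "finite ?A" "Poly_Mapping.keys (p + p') \<subseteq> ?A"
    by (simp_all add: keys_add)
  then show ?thesis
    by (simp add: coords_lie_superset[where A = ?A and B = "Poly_Mapping.keys q"] lookup_add
        distrib_right coords.scale_left_distrib sum.distrib)
qed

lemma coords_lie_scale_left: "coords_lie (coords_scale c p) q = coords_scale c (coords_lie p q)"
proof -
  have "Poly_Mapping.keys (coords_scale c p) \<subseteq> Poly_Mapping.keys p"
    by (auto simp: in_keys_iff)
  then show ?thesis
    by (simp add: coords_lie_superset[where A = "Poly_Mapping.keys p" and B = "Poly_Mapping.keys q"]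
        coords.scale_sum_right mult.assoc)
qed

lemma loop_coords_uminus: "loop_coords (\<lambda>a. - x a) m n = - loop_coords x m n"
  by (simp add: loop_coords_def single_uminus)

lemma basis_bracket_antisym: "basis_bracket b a = - basis_bracket a b"
proof (cases "(a, b)" rule: basis_bracket.cases)
  case (1 x r1 r2 y s1 s2)
  have "sl2_bracket y x = (\<lambda>c. - sl2_bracket x y c)" "sl2_form y x = sl2_form x y"
    by (cases x; cases y; auto)+
  then show ?thesis
    using 1 by (auto simp: loop_coords_uminus add.commute simp flip: single_uminus)
qed auto

lemma coords_lie_antisym: "coords_lie q p = - coords_lie p q"
  unfolding coords_lie_def
  by (subst sum.swap, subst basis_bracket_antisym)
    (simp add: sum_negf mult.commute)

lemma coords_lie_add_right: "coords_lie q (p + p') = coords_lie q p + coords_lie q p'"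
  using coords_lie_antisym[of q] by (simp add: coords_lie_add_left)

lemma coords_lie_scale_right: "coords_lie q (coords_scale c p) = coords_scale c (coords_lie q p)"
  using coords_lie_antisym[of q] by (simp add: coords_lie_scale_left)

lemma coords_lie_self: "coords_lie p p = 0"
proof -
  have "coords_lie p p + coords_lie p p = 0"
    using coords_lie_antisym[of p p] unfolding eq_neg_iff_add_eq_0 .
  then have "Poly_Mapping.lookup (coords_lie p p) k + Poly_Mapping.lookup (coords_lie p p) k = 0" for k
    unfolding lookup_add[symmetric] by simp
  then show ?thesis
    by (intro poly_mapping_eqI) simp
qed

lemma coords_lie_basis:
  "coords_lie (Poly_Mapping.single a s) (Poly_Mapping.single b t) = coords_scale (s * t) (basis_bracket a b)"
  by (simp add: coords_lie_superset[of "{a}" _ "{b}"])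

lemma coords_lie_uminus_right: "coords_lie q (- p) = - coords_lie q p"
  using coords_lie_add_right[of q p "- p"] coords_lie_add_right[of q 0 0]
  by (simp add: eq_neg_iff_add_eq_0 add.commute)

lemma coords_lie_zero_right: "coords_lie q 0 = 0"
  using coords_lie_add_right[of q 0 0] by simp

lemma coords_induct [case_names zero single_step]:
  assumes "P 0" "\<And>a s p. P p \<Longrightarrow> P (coords_scale s (Poly_Mapping.single a 1) + p)"
  shows "P (p :: 'b \<Rightarrow>\<^sub>0 complex)"
proof -
  have "\<forall>p. Poly_Mapping.keys p = A \<longrightarrow> P p" if "finite A" for A
    using that
  proof (induction A)
    case (insert a A)
    show ?case
    proof (intro allI impI)
      fix p :: "'b \<Rightarrow>\<^sub>0 complex"
      assume p: "Poly_Mapping.keys p = insert a A"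
      let ?m = "coords_scale (Poly_Mapping.lookup p a) (Poly_Mapping.single a 1)"
      have m: "Poly_Mapping.lookup ?m b = (if b = a then Poly_Mapping.lookup p a else 0)" for b
        by (simp add: lookup_single when_def)
      have "Poly_Mapping.keys (p - ?m) = A"
      proof (intro set_eqI)
        fix b
        have "b \<in> insert a A \<longleftrightarrow> Poly_Mapping.lookup p b \<noteq> 0"
          unfolding p[symmetric] by (rule in_keys_iff)
        then show "b \<in> Poly_Mapping.keys (p - ?m) \<longleftrightarrow> b \<in> A"
          using insert.hyps unfolding in_keys_iff lookup_minus m by (cases "b = a") auto
      qed
      then have "P (?m + (p - ?m))"
        using insert.IH assms(2)[of "p - ?m"] by blast
      then show "P p"
        by simp
    qed
  qed (use assms(1) in auto)
  from this[of "Poly_Mapping.keys p"] show ?thesis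
    by simp
qed

lemma coords_lie_basis1:
  "coords_lie (Poly_Mapping.single a 1) (Poly_Mapping.single b t) = coords_scale t (basis_bracket a b)"
  by (simp add: coords_lie_basis)

lemma loop_coords_add: "loop_coords (\<lambda>a. x a + y a) m n = loop_coords x m n + loop_coords y m n"
  by (simp add: loop_coords_def single_add)

lemma loop_coords_scale: "loop_coords (\<lambda>a. c * x a) m n = coords_scale c (loop_coords x m n)"
  by (intro poly_mapping_eqI) (simp add: loop_coords_def lookup_add lookup_single when_def distrib_left)

lemma coords_scale_single: "coords_scale c (Poly_Mapping.single a s) = Poly_Mapping.single a (c * s)"
  by (intro poly_mapping_eqI) (simp add: lookup_single when_def)

lemma coords_lie_loop:
  "coords_lie (Poly_Mapping.single (Loop a r1 r2) 1) (loop_coords v m n) =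
     loop_coords (\<lambda>c. v E * sl2_bracket a E c + v F * sl2_bracket a F c + v H * sl2_bracket a H c) (r1 + m) (r2 + n) +
     (if r1 = - m \<and> r2 = - n
      then let k = v E * sl2_form a E + v F * sl2_form a F + v H * sl2_form a H
        in Poly_Mapping.single C1 (k * of_int r1) + Poly_Mapping.single C2 (k * of_int r2)
      else 0)"
proof -
  define K where "K z = Poly_Mapping.single C1 (z * of_int r1) + Poly_Mapping.single C2 (z * of_int r2)"
    for z :: complex
  define C where "C z = (if r1 = - m \<and> r2 = - n then K z else 0)" for z
  have K_add: "K (z + w) = K z + K w" for z w
    by (simp only: K_def distrib_right single_add add_ac)
  have K_scale: "K (s * z) = coords_scale s (K z)" for s z
    by (simp only: K_def coords.scale_right_distrib coords_scale_single mult.assoc)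
  have bb: "basis_bracket (Loop a r1 r2) (Loop b m n) = loop_coords (sl2_bracket a b) (r1 + m) (r2 + n) + C (sl2_form a b)" for b
    by (simp only: basis_bracket.simps C_def K_def)
  have C_add: "C (z + w) = C z + C w" for z w
    by (simp add: C_def K_add)
  have C_scale: "C (s * z) = coords_scale s (C z)" for s z
    by (simp add: C_def K_scale)
  have "coords_lie (Poly_Mapping.single (Loop a r1 r2) 1) (loop_coords v m n) =
    coords_scale (v E) (basis_bracket (Loop a r1 r2) (Loop E m n)) +
    coords_scale (v F) (basis_bracket (Loop a r1 r2) (Loop F m n)) +
    coords_scale (v H) (basis_bracket (Loop a r1 r2) (Loop H m n))"
    by (simp add: loop_coords_def coords_lie_add_right coords_lie_basis1 add.assoc del: basis_bracket.simps)
  also have "\<dots> =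
     loop_coords (\<lambda>c. v E * sl2_bracket a E c + v F * sl2_bracket a F c + v H * sl2_bracket a H c) (r1 + m) (r2 + n) +
     C (v E * sl2_form a E + v F * sl2_form a F + v H * sl2_form a H)"
    unfolding bb loop_coords_add loop_coords_scale C_add C_scale coords.scale_right_distrib
    by (simp only: add_ac)
  finally show ?thesis
    by (simp only: C_def K_def Let_def)
qed

lemma coords_lie_double_loop:
  "coords_lie (Poly_Mapping.single (Loop a r1 r2) 1) (basis_bracket (Loop b s1 s2) (Loop c t1 t2)) =
   coords_lie (Poly_Mapping.single (Loop a r1 r2) 1) (loop_coords (sl2_bracket b c) (s1 + t1) (s2 + t2))"
  by (simp add: coords_lie_add_right coords_lie_basis1 coords_lie_zero_right)

lemma coords_jacobi_loop:
  "coords_lie (Poly_Mapping.single (Loop a r1 r2) 1) (basis_bracket (Loop b s1 s2) (Loop c t1 t2)) +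
   coords_lie (Poly_Mapping.single (Loop b s1 s2) 1) (basis_bracket (Loop c t1 t2) (Loop a r1 r2)) +
   coords_lie (Poly_Mapping.single (Loop c t1 t2) 1) (basis_bracket (Loop a r1 r2) (Loop b s1 s2)) = 0"
proof -
  define ad where "ad a v = (\<lambda>c. v E * sl2_bracket a E c + v F * sl2_bracket a F c + v H * sl2_bracket a H c)"
    for a and v :: sl2
  define k where "k a v = v E * sl2_form a E + v F * sl2_form a F + v H * sl2_form a H" for a and v :: sl2
  define cen where "cen z m n = Poly_Mapping.single C1 (z * of_int m) + Poly_Mapping.single C2 (z * of_int n)"
    for z :: complex and m n :: int
  have cen_add: "cen z m n + cen z m' n' = cen z (m + m') (n + n')" for z m n m' n'
    by (simp add: cen_def distrib_left single_add add_ac)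
  have br: "coords_lie (Poly_Mapping.single (Loop a r1 r2) 1) (basis_bracket (Loop b s1 s2) (Loop c t1 t2)) =
    loop_coords (ad a (sl2_bracket b c)) (r1 + s1 + t1) (r2 + s2 + t2) +
    (if r1 + s1 + t1 = 0 \<and> r2 + s2 + t2 = 0 then cen (k a (sl2_bracket b c)) r1 r2 else 0)"
    for a b c r1 r2 s1 s2 t1 t2
  proof -
    have "(r1 = - (s1 + t1) \<and> r2 = - (s2 + t2)) = (r1 + s1 + t1 = 0 \<and> r2 + s2 + t2 = 0)"
      by auto
    then show ?thesis
      unfolding coords_lie_double_loop coords_lie_loop ad_def k_def cen_def Let_def
      by (simp only: add.assoc)
  qed
  have "ad a (sl2_bracket b c) d + ad b (sl2_bracket c a) d + ad c (sl2_bracket a b) d = 0" for d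
    by (cases a; cases b; cases c; cases d) (simp_all add: ad_def)
  then have "loop_coords (\<lambda>d. ad a (sl2_bracket b c) d + ad b (sl2_bracket c a) d + ad c (sl2_bracket a b) d) m n = 0" for m n
    by (simp add: loop_coords_def)
  then have ad: "loop_coords (ad a (sl2_bracket b c)) m n + loop_coords (ad b (sl2_bracket c a)) m n +
      loop_coords (ad c (sl2_bracket a b)) m n = 0" for m n
    by (simp add: loop_coords_add)
  have k: "k b (sl2_bracket c a) = k a (sl2_bracket b c)" "k c (sl2_bracket a b) = k a (sl2_bracket b c)"
    by (cases a; cases b; cases c; simp add: k_def)+
  have perm: "s1 + t1 + r1 = r1 + s1 + t1" "s2 + t2 + r2 = r2 + s2 + t2"
    "t1 + r1 + s1 = r1 + s1 + t1" "t2 + r2 + s2 = r2 + s2 + t2"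
    by simp_all
  show ?thesis
  proof (cases "r1 + s1 + t1 = 0 \<and> r2 + s2 + t2 = 0")
    case True
    have "cen (k a (sl2_bracket b c)) r1 r2 + cen (k a (sl2_bracket b c)) s1 s2 + cen (k a (sl2_bracket b c)) t1 t2 = 0"
      unfolding cen_add using True by (simp add: cen_def)
    then show ?thesis
      using True ad[of 0 0] unfolding br perm k by (simp add: add_ac)
  next
    case False
    then show ?thesis
      using ad unfolding br perm if_not_P[OF False] by simp
  qed
qed

fun toroidal_degree :: "toroidal_basis \<Rightarrow> toroidal_basis \<Rightarrow> complex" where
  "toroidal_degree D1 (Loop a m n) = of_int m"
| "toroidal_degree D2 (Loop a m n) = of_int n"
| "toroidal_degree _ _ = 0"

lemma basis_bracket_D: "d = D1 \<or> d = D2 \<Longrightarrow> basis_bracket d b = Poly_Mapping.single b (toroidal_degree d b)"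
  by (cases b) auto

lemma coords_lie_D_basis_bracket:
  assumes "d = D1 \<or> d = D2"
  shows "coords_lie (Poly_Mapping.single d 1) (basis_bracket b c) =
    coords_scale (toroidal_degree d b + toroidal_degree d c) (basis_bracket b c)"
proof (cases "(b, c)" rule: basis_bracket.cases)
  case (1 x r1 r2 y s1 s2)
  then show ?thesis
    using assms
    by (auto simp: loop_coords_def coords_lie_add_right coords_lie_basis1 coords_lie_zero_right coords_scale_single
        coords.scale_right_distrib mult.commute simp flip: of_int_add)
qed (use assms in \<open>auto simp: coords_lie_basis1 coords_lie_zero_right coords_lie_uminus_right coords_scale_single mult.commute\<close>)

lemma coords_jacobi_basis:
  "coords_lie (Poly_Mapping.single a 1) (basis_bracket b c) +
   coords_lie (Poly_Mapping.single b 1) (basis_bracket c a) +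
   coords_lie (Poly_Mapping.single c 1) (basis_bracket a b) = 0"
proof -
  define J where "J a b c = coords_lie (Poly_Mapping.single a 1) (basis_bracket b c) +
   coords_lie (Poly_Mapping.single b 1) (basis_bracket c a) +
   coords_lie (Poly_Mapping.single c 1) (basis_bracket a b)" for a b c
  have cyc: "J a b c = J b c a" for a b c
    by (simp add: J_def add_ac)
  have nonloop: "J a b c = 0" if nl: "\<nexists>x m n. a = Loop x m n" for a b c
  proof -
    consider "a = C1 \<or> a = C2" | "a = D1 \<or> a = D2"
      using nl by (cases a) auto
    then show ?thesis
    proof cases
      case 1
      then have "basis_bracket a x = 0" "basis_bracket x a = 0" for x
        by (cases x; auto)+
      moreover have "coords_lie (Poly_Mapping.single a 1) q = 0" for q
        unfolding coords_lie_def using calculation by simp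
      ultimately show ?thesis
        by (simp add: J_def coords_lie_zero_right)
    next
      case 2
      have "basis_bracket c a = - Poly_Mapping.single c (toroidal_degree a c)"
        using basis_bracket_antisym[of c a] basis_bracket_D[OF 2] by simp
      then show ?thesis
        unfolding J_def coords_lie_D_basis_bracket[OF 2] basis_bracket_D[OF 2]
        using basis_bracket_antisym[of c b]
        by (simp add: coords_lie_uminus_right coords_lie_basis1 coords.scale_left_distrib)
    qed
  qed
  have "J a b c = 0"
  proof (cases "(\<exists>x m n. a = Loop x m n) \<and> (\<exists>x m n. b = Loop x m n) \<and> (\<exists>x m n. c = Loop x m n)")
    case True
    then show ?thesis
      unfolding J_def by (auto simp del: basis_bracket.simps simp: coords_jacobi_loop)
  next
    case False
    then show ?thesis
      using nonloop[of a b c] nonloop[of b c a] nonloop[of c a b] cyc[of a b c] cyc[of b c a] by auto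
  qed
  then show ?thesis
    by (simp add: J_def)
qed

lemma coords_jacobi:
  "coords_lie p (coords_lie q r) + coords_lie q (coords_lie r p) + coords_lie r (coords_lie p q) = 0"
proof -
  have add: "coords_lie (u + p) (coords_lie q r) + coords_lie q (coords_lie r (u + p)) + coords_lie r (coords_lie (u + p) q)
    = (coords_lie u (coords_lie q r) + coords_lie q (coords_lie r u) + coords_lie r (coords_lie u q)) +
      (coords_lie p (coords_lie q r) + coords_lie q (coords_lie r p) + coords_lie r (coords_lie p q))" for u p q r
    by (simp add: coords_lie_add_left coords_lie_add_right algebra_simps)
  have scale: "coords_lie (coords_scale s p) (coords_lie q r) + coords_lie q (coords_lie r (coords_scale s p)) + coords_lie r (coords_lie (coords_scale s p) q)
    = coords_scale s (coords_lie p (coords_lie q r) + coords_lie q (coords_lie r p) + coords_lie r (coords_lie p q))" for s p q r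
    by (simp add: coords_lie_scale_left coords_lie_scale_right coords.scale_right_distrib)
  define J where "J p q r = coords_lie p (coords_lie q r) + coords_lie q (coords_lie r p) + coords_lie r (coords_lie p q)" for p q r
  have cyc: "J p q r = J q r p" for p q r
    by (simp add: J_def algebra_simps)
  have step: "J p q r = 0" if "\<And>a. J (Poly_Mapping.single a 1) q r = 0" for p q r
  proof (induction p rule: coords_induct)
    case zero
    have "J (0 + 0) q r = J 0 q r + J 0 q r"
      unfolding J_def by (rule add)
    then show ?case by simp
  next
    case (single_step a s p)
    then show ?case
      using that[of a] unfolding J_def add scale by simp
  qed
  have "J (Poly_Mapping.single a 1) (Poly_Mapping.single b 1) (Poly_Mapping.single c 1) = 0" for a b c
    unfolding J_def coords_lie_basis1 coords.scale_one by (rule coords_jacobi_basis)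
  then have "J p (Poly_Mapping.single b 1) (Poly_Mapping.single c 1) = 0" for p b c
    by (rule step)
  then have "J (Poly_Mapping.single b 1) (Poly_Mapping.single c 1) p = 0" for p b c
    by (metis cyc)
  then have "J q (Poly_Mapping.single c 1) p = 0" for q p c
    by (rule step)
  then have "J (Poly_Mapping.single c 1) p q = 0" for q p c
    by (metis cyc)
  then have "J r p q = 0" for p q r
    by (rule step)
  then show ?thesis
    by (simp flip: J_def)
qed

typedef toroidal = "UNIV :: (toroidal_basis \<Rightarrow>\<^sub>0 complex) set"
  morphisms coords of_coords
  by simp

setup_lifting type_definition_toroidal

instantiation toroidal :: complex_lie_algebra
begin

lift_definition zero_toroidal :: toroidal is 0 .
lift_definition plus_toroidal :: "toroidal \<Rightarrow> toroidal \<Rightarrow> toroidal" is "(+)" .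
lift_definition uminus_toroidal :: "toroidal \<Rightarrow> toroidal" is uminus .
lift_definition minus_toroidal :: "toroidal \<Rightarrow> toroidal \<Rightarrow> toroidal" is "(-)" .
lift_definition scaleC_toroidal :: "complex \<Rightarrow> toroidal \<Rightarrow> toroidal" is coords_scale .
lift_definition lie_toroidal :: "toroidal \<Rightarrow> toroidal \<Rightarrow> toroidal" is coords_lie .

instance
proof
  fix x y z :: toroidal and c d :: complex
  show "x + y + z = x + (y + z)" by transfer (rule add.assoc)
  show "x + y = y + x" by transfer (rule add.commute)
  show "0 + x = x" by transfer simp
  show "- x + x = 0" by transfer simp
  show "x - y = x + - y" by transfer simp
  show "c *\<^sub>C (x + y) = c *\<^sub>C x + c *\<^sub>C y" by transfer (rule coords.scale_right_distrib)
  show "(c + d) *\<^sub>C x = c *\<^sub>C x + d *\<^sub>C x" by transfer (rule coords.scale_left_distrib)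
  show "c *\<^sub>C (d *\<^sub>C x) = (c * d) *\<^sub>C x" by transfer simp
  show "1 *\<^sub>C x = x" by transfer simp
  show "lie (x + y) z = lie x z + lie y z" by transfer (rule coords_lie_add_left)
  show "lie x (y + z) = lie x y + lie x z" by transfer (rule coords_lie_add_right)
  show "lie (c *\<^sub>C x) y = c *\<^sub>C lie x y" by transfer (rule coords_lie_scale_left)
  show "lie x (c *\<^sub>C y) = c *\<^sub>C lie x y" by transfer (rule coords_lie_scale_right)
  show "lie x x = 0" by transfer (rule coords_lie_self)
  show "lie x (lie y z) + lie y (lie z x) + lie z (lie x y) = 0" by transfer (rule coords_jacobi)
qed

end

lift_definition loop :: "sl2 \<Rightarrow> int \<Rightarrow> int \<Rightarrow> toroidal" is loop_coords .
lift_definition basis_vec :: "toroidal_basis \<Rightarrow> toroidal" is "\<lambda>a. Poly_Mapping.single a 1" .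

lemma lie_basis_vec: "lie (basis_vec a) (basis_vec b) = of_coords (basis_bracket a b)"
  by (rule coords_inject[THEN iffD1])
    (simp add: lie_toroidal.rep_eq basis_vec.rep_eq of_coords_inverse coords_lie_basis)

abbreviation e_loop :: "int \<Rightarrow> int \<Rightarrow> toroidal" where "e_loop m n \<equiv> basis_vec (Loop E m n)"
abbreviation f_loop :: "int \<Rightarrow> int \<Rightarrow> toroidal" where "f_loop m n \<equiv> basis_vec (Loop F m n)"
abbreviation h_loop :: "int \<Rightarrow> int \<Rightarrow> toroidal" where "h_loop m n \<equiv> basis_vec (Loop H m n)"

definition cartan :: "toroidal set" where
  "cartan = lie_vs.span {h_loop 0 0, basis_vec C1, basis_vec C2, basis_vec D1, basis_vec D2}"

definition toroidal_pos :: "toroidal set" where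
  "toroidal_pos = lie_vs.span
     ({e_loop m 0 |m. m \<ge> 0} \<union> {f_loop m 0 |m. m \<ge> 1} \<union> {h_loop m 0 |m. m \<ge> 1} \<union>
      {loop x m n |x m n. n \<ge> 1})"

text \<open>
  A weight is a function on the whole algebra of which only the restriction to the Cartan
  subalgebra is relevant; that restriction has to be linear.
\<close>

definition is_weight :: "(toroidal \<Rightarrow> complex) \<Rightarrow> bool" where
  "is_weight lam \<longleftrightarrow>
     (\<forall>x\<in>cartan. \<forall>y\<in>cartan. lam (x + y) = lam x + lam y) \<and>
     (\<forall>c. \<forall>x\<in>cartan. lam (c *\<^sub>C x) = c * lam x)"

definition root_alpha :: "toroidal \<Rightarrow> complex" where
  "root_alpha x = 2 * Poly_Mapping.lookup (coords x) (Loop H 0 0)"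

definition root_delta1 :: "toroidal \<Rightarrow> complex" where
  "root_delta1 x = Poly_Mapping.lookup (coords x) D1"

definition root_alpha0 :: "toroidal \<Rightarrow> complex" where
  "root_alpha0 x = root_delta1 x - root_alpha x"

definition Q1_plus :: "(toroidal \<Rightarrow> complex) set" where
  "Q1_plus = {\<lambda>x. of_nat m * root_alpha0 x + of_nat n * root_alpha x |m n :: nat. True}"


section \<open>Verma modules\<close>

text \<open>
  \<open>borel_action lam\<close> is the set of all pairs of the image of \<open>b\<close> in the enveloping algebra of
  the toroidal algebra and the scalar by which \<open>b\<close> acts on \<open>1\<^sub>\<lambda>\<close>, where \<open>b\<close> runs through the
  enveloping algebra of \<open>toroidal_pos \<oplus> cartan\<close>.
\<close>

inductive_set borel_action :: "(toroidal \<Rightarrow> complex) \<Rightarrow> (toroidal uea \<times> complex) set"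
  for lam :: "toroidal \<Rightarrow> complex" where
  borel_pos: "x \<in> toroidal_pos \<Longrightarrow> (uea_incl x, 0) \<in> borel_action lam"
| borel_cartan: "h \<in> cartan \<Longrightarrow> (uea_incl h, lam h) \<in> borel_action lam"
| borel_one: "(1, 1) \<in> borel_action lam"
| borel_scale: "(a, s) \<in> borel_action lam \<Longrightarrow> (uea_scale c a, c * s) \<in> borel_action lam"
| borel_add: "(a, s) \<in> borel_action lam \<Longrightarrow> (b, t) \<in> borel_action lam \<Longrightarrow> (a + b, s + t) \<in> borel_action lam"
| borel_mult: "(a, s) \<in> borel_action lam \<Longrightarrow> (b, t) \<in> borel_action lam \<Longrightarrow> (a * b, s * t) \<in> borel_action lam"

text \<open>
  Identify \<open>u \<otimes> z 1\<^sub>\<lambda>\<close> in the tensor product of \<open>U(\<TT>)\<close> and \<open>\<complex> 1\<^sub>\<lambda>\<close> over \<open>\<complex>\<close> with \<open>z u\<close>. The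
  tensor product over the enveloping algebra of \<open>toroidal_pos \<oplus> cartan\<close> is then the quotient of
  \<open>U(\<TT>)\<close> by the span of the balancing relations \<open>u b \<otimes> 1\<^sub>\<lambda> - u \<otimes> b 1\<^sub>\<lambda>\<close>. Its elements are the
  cosets of that span, its zero is the span itself, and the sum of two cosets is the
  elementwise sum of sets.
\<close>

definition verma_rel :: "(toroidal \<Rightarrow> complex) \<Rightarrow> toroidal uea set" where
  "verma_rel lam = uea_vs.span {u * b - uea_scale s u |u b s. (b, s) \<in> borel_action lam}"

definition verma :: "(toroidal \<Rightarrow> complex) \<Rightarrow> toroidal uea set set" where
  "verma lam = {u +o verma_rel lam |u. True}"

definition verma_act :: "(toroidal \<Rightarrow> complex) \<Rightarrow> toroidal \<Rightarrow> toroidal uea set \<Rightarrow> toroidal uea set" where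
  "verma_act lam x v = uea_incl x *o v + verma_rel lam"

definition verma_scale :: "(toroidal \<Rightarrow> complex) \<Rightarrow> complex \<Rightarrow> toroidal uea set \<Rightarrow> toroidal uea set" where
  "verma_scale lam c v = uea_scale c ` v + verma_rel lam"

lemma verma_rel_mult: "u \<in> verma_rel lam \<Longrightarrow> a * u \<in> verma_rel lam"
proof (unfold verma_rel_def, induction rule: uea_vs.span_induct_alt)
  case base
  then show ?case
    by (simp add: uea_vs.span_zero)
next
  case (step c x y)
  then obtain u b s where x: "x = u * b - uea_scale s u" and b: "(b, s) \<in> borel_action lam"
    by blast
  have "a * (u * b - uea_scale s u) = (a * u) * b - uea_scale s (a * u)"
    by (simp add: right_diff_distrib mult_uea_scale_right mult.assoc)
  then have "a * x \<in> uea_vs.span {u * b - uea_scale s u |u b s. (b, s) \<in> borel_action lam}"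
    unfolding x by (intro uea_vs.span_base) (use b in blast)
  then show ?case
    using step by (simp add: distrib_left mult_uea_scale_right uea_vs.span_add uea_vs.span_scale)
qed

lemma verma_rel_zero: "0 \<in> verma_rel lam"
  unfolding verma_rel_def by (rule uea_vs.span_zero)

lemma verma_rel_add: "u \<in> verma_rel lam \<Longrightarrow> v \<in> verma_rel lam \<Longrightarrow> u + v \<in> verma_rel lam"
  unfolding verma_rel_def by (rule uea_vs.span_add)

lemma verma_rel_scale: "u \<in> verma_rel lam \<Longrightarrow> uea_scale c u \<in> verma_rel lam"
  unfolding verma_rel_def by (rule uea_vs.span_scale)

lemma verma_coset_image:
  assumes "\<And>u v. g (u + v) = g u + g v" "\<And>v. v \<in> verma_rel lam \<Longrightarrow> g v \<in> verma_rel lam"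
  shows "g ` (u +o verma_rel lam) + verma_rel lam = g u +o verma_rel lam"
proof (intro set_eqI iffI)
  fix w
  assume "w \<in> g ` (u +o verma_rel lam) + verma_rel lam"
  then obtain v v' where "w = g u + (g v + v')" "v \<in> verma_rel lam" "v' \<in> verma_rel lam"
    by (auto simp: set_plus_def elt_set_plus_def assms(1) add.assoc)
  then show "w \<in> g u +o verma_rel lam"
    using assms(2) verma_rel_add by (auto simp: elt_set_plus_def)
next
  fix w
  assume "w \<in> g u +o verma_rel lam"
  moreover have "u \<in> u +o verma_rel lam"
    using verma_rel_zero by (force simp: elt_set_plus_def)
  ultimately show "w \<in> g ` (u +o verma_rel lam) + verma_rel lam"
    by (auto simp: set_plus_def elt_set_plus_def)
qed

lemma verma_act_coset: "verma_act lam x (u +o verma_rel lam) = (uea_incl x * u) +o verma_rel lam"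
proof -
  have "uea_incl x *o v = (*) (uea_incl x) ` v" for v
    by (auto simp: elt_set_times_def)
  then show ?thesis
    unfolding verma_act_def by (simp add: verma_coset_image distrib_left verma_rel_mult)
qed

lemma verma_scale_coset: "verma_scale lam c (u +o verma_rel lam) = uea_scale c u +o verma_rel lam"
  unfolding verma_scale_def
  by (simp add: verma_coset_image uea_vs.scale_right_distrib verma_rel_scale)

definition verma_weight_space ::
    "(toroidal \<Rightarrow> complex) \<Rightarrow> (toroidal \<Rightarrow> complex) \<Rightarrow> toroidal uea set set" where
  "verma_weight_space lam mu =
     {v \<in> verma lam. \<forall>h\<in>cartan. verma_act lam h v = verma_scale lam (mu h) v}"

definition verma_singular :: "(toroidal \<Rightarrow> complex) \<Rightarrow> toroidal uea set set" where
  "verma_singular lam = {v \<in> verma lam. \<forall>x\<in>toroidal_pos. verma_act lam x v = verma_rel lam}"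

text \<open>The leading \<open>verma_rel lam\<close> is the zero vector; it makes the empty sum a coset.\<close>

definition verma_Q1_part :: "(toroidal \<Rightarrow> complex) \<Rightarrow> toroidal uea set set" where
  "verma_Q1_part lam =
     {verma_rel lam + (\<Sum>\<eta>\<in>S. w \<eta>) |S w. finite S \<and> S \<subseteq> Q1_plus \<and>
        (\<forall>\<eta>\<in>S. w \<eta> \<in> verma_weight_space lam (\<lambda>h. lam h - \<eta> h))}"

end

theory Submission
  imports Defs "HOL-Library.Multiset" "HOL-Library.Countable"
begin

text \<open>
  By the Poincare-Birkhoff-Witt theorem the Verma module has a basis of ordered monomials in the
  basis vectors of \<open>\<TT>\<^sub>-\<close>, applied to the highest weight vector. Filter it by the length of the
  monomials. An element \<open>p\<close> of \<open>\<TT>\<^sub>+\<close> acts on leading terms as a derivation: it replaces one factor \<open>a\<close> of a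
  monomial by the component of \<open>[p, a]\<close> in \<open>\<TT>\<^sub>-\<close>, and everything else is shorter.

  Let \<open>v\<close> be singular, so that every \<open>y(r,1)\<close> annihilates it. Each \<open>y(r,1)\<close> annihilates the
  monomials whose factors all have \<open>t\<^sub>2\<close>-degree 0, because commuting it past such a factor leaves an
  element \<open>z(s,1)\<close> of \<open>\<TT>\<^sub>+\<close>. Suppose that some monomial of \<open>v\<close> has a factor of negative
  \<open>t\<^sub>2\<close>-degree. Take a longest such monomial \<open>S\<close>, let \<open>c(m,n)\<close> with \<open>n < 0\<close> be such a factor, and let
  \<open>r\<close> be very negative. Then \<open>y(r,1)\<close> turns this factor into \<open>[y,c](m+r,n+1)\<close>, which lies in \<open>\<TT>\<^sub>-\<close>
  again and does not occur in \<open>v\<close>. Such a fresh factor shows where it comes from: choose \<open>y\<close> so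
  that some coordinate of \<open>[y,c']\<close> is nonzero exactly for \<open>c' = c\<close> among the basis elements of
  \<open>sl\<^sub>2\<close>. Then the monomial that has the fresh factor in place of \<open>c(m,n)\<close> receives a contribution
  from \<open>S\<close> only, so its coefficient in \<open>y(r,1) v\<close> is nonzero, a contradiction. Hence \<open>v\<close> is a
  combination of monomials in the affine negative basis vectors \<open>f(-m,0)\<close> (\<open>m \<ge> 0\<close>), \<open>e(-m,0)\<close> and
  \<open>\<alpha>\<^sup>\<vee>(-m,0)\<close> (\<open>m \<ge> 1\<close>), and these are weight vectors of weights \<open>\<lambda> - \<eta>\<close> with \<open>\<eta>\<close> in \<open>Q1_plus\<close>.

  The basis theorem is proved for the induced module directly. The locale \<open>induced_module\<close> builds an
  action on the polynomials in the negative basis vectors which has the highest weight already built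
  in; \<open>commutator\<close> says that it is a module. Thus the universal enveloping algebra acts on
  the polynomials (\<open>lie_module\<close>), and applying it to the empty monomial gives coordinates on the
  Verma module: they are well defined by \<open>verma_coords_rel\<close>, and they determine the vector by
  \<open>pbw_spanning\<close>. The fresh factor argument is \<open>lookup_act_fresh\<close> and \<open>affine_if_degree_one_kills\<close>,
  and the weights are computed in \<open>cartan_mult_pbw_monomial\<close>.
\<close>

section \<open>Linear extension of functions on a basis\<close>

definition lin_ext :: "(complex \<Rightarrow> 'v \<Rightarrow> 'v) \<Rightarrow> ('k \<Rightarrow> 'v) \<Rightarrow> ('k \<Rightarrow>\<^sub>0 complex) \<Rightarrow> 'v::ab_group_add" where
  "lin_ext s g p = (\<Sum>k\<in>Poly_Mapping.keys p. s (Poly_Mapping.lookup p k) (g k))"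

locale complex_space = vector_space s for s :: "complex \<Rightarrow> 'v \<Rightarrow> 'v::ab_group_add"
begin

lemma lin_ext_superset:
  assumes "finite A" "Poly_Mapping.keys p \<subseteq> A"
  shows "lin_ext s g p = (\<Sum>k\<in>A. s (Poly_Mapping.lookup p k) (g k))"
  unfolding lin_ext_def using assms by (intro sum.mono_neutral_left) (auto simp: in_keys_iff)

lemma lin_ext_zero [simp]: "lin_ext s g 0 = 0"
  by (simp add: lin_ext_def)

lemma lin_ext_single [simp]: "lin_ext s g (Poly_Mapping.single k c) = s c (g k)"
  by (simp add: lin_ext_superset[of "{k}"])

lemma lin_ext_add: "lin_ext s g (p + q) = lin_ext s g p + lin_ext s g q"
proof -
  let ?A = "Poly_Mapping.keys p \<union> Poly_Mapping.keys q"
  have "Poly_Mapping.keys (p + q) \<subseteq> ?A"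
    by (simp add: keys_add)
  then show ?thesis
    by (simp add: lin_ext_superset[of ?A] lookup_add scale_left_distrib sum.distrib)
qed

lemma lin_ext_scale: "lin_ext s g (coords_scale c p) = s c (lin_ext s g p)"
proof -
  have "Poly_Mapping.keys (coords_scale c p) \<subseteq> Poly_Mapping.keys p"
    by (auto simp: in_keys_iff)
  then show ?thesis
    by (simp add: lin_ext_superset[of "Poly_Mapping.keys p"] scale_sum_right)
qed

lemma lin_ext_uminus: "lin_ext s g (- p) = - lin_ext s g p"
  using lin_ext_add[of g p "- p"] by (simp add: eq_neg_iff_add_eq_0 add.commute)

lemma lin_ext_diff: "lin_ext s g (p - q) = lin_ext s g p - lin_ext s g q"
  using lin_ext_add[of g p "- q"] by (simp add: lin_ext_uminus)

lemma lin_ext_cong: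
  assumes "\<And>k. k \<in> Poly_Mapping.keys p \<Longrightarrow> g k = h k"
  shows "lin_ext s g p = lin_ext s h p"
  using assms by (simp add: lin_ext_def)

lemma lin_ext_const_zero [simp]: "lin_ext s (\<lambda>k. 0) p = 0"
  by (simp add: lin_ext_def)

lemma lin_ext_fun_add: "lin_ext s (\<lambda>k. g k + h k) p = lin_ext s g p + lin_ext s h p"
  by (simp add: lin_ext_def scale_right_distrib sum.distrib)

lemma lin_ext_fun_diff: "lin_ext s (\<lambda>k. g k - h k) p = lin_ext s g p - lin_ext s h p"
  by (simp add: lin_ext_def scale_right_diff_distrib sum_subtractf)

lemma lin_ext_fun_scale: "lin_ext s (\<lambda>k. s c (g k)) p = s c (lin_ext s g p)"
  by (simp add: lin_ext_def scale_sum_right mult.commute)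

lemma lin_ext_lin_ext: "lin_ext s g (lin_ext coords_scale h p) = lin_ext s (\<lambda>k. lin_ext s g (h k)) p"
proof -
  have "lin_ext s g (\<Sum>k\<in>A. coords_scale (c k) (h k)) = (\<Sum>k\<in>A. s (c k) (lin_ext s g (h k)))" for A c
    by (induction A rule: infinite_finite_induct) (simp_all add: lin_ext_add lin_ext_scale)
  then show ?thesis
    by (simp add: lin_ext_def[of _ h] lin_ext_def[of _ "\<lambda>k. lin_ext s g (h k)"])
qed

end

interpretation poly: complex_space coords_scale ..
lemma keys_add_cases: "i \<in> Poly_Mapping.keys (p + q) \<Longrightarrow> i \<in> Poly_Mapping.keys p \<or> i \<in> Poly_Mapping.keys q"
  by (auto simp: in_keys_iff lookup_add)

lemma lookup_lin_ext:
  "Poly_Mapping.lookup (lin_ext coords_scale g p) i = (\<Sum>k\<in>Poly_Mapping.keys p. Poly_Mapping.lookup p k * Poly_Mapping.lookup (g k) i)"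
  by (simp add: lin_ext_def lookup_sum)

lemma lin_ext_id:
  fixes p :: "'k \<Rightarrow>\<^sub>0 complex"
  shows "lin_ext coords_scale (\<lambda>k. Poly_Mapping.single k 1) p = p"
  by (rule poly_mapping_eqI) (auto simp: lookup_lin_ext lookup_single when_def in_keys_iff if_distrib cong: if_cong)

lemma keys_lin_ext:
  assumes "i \<in> Poly_Mapping.keys (lin_ext coords_scale g p)"
  obtains k where "k \<in> Poly_Mapping.keys p" "i \<in> Poly_Mapping.keys (g k)"
proof -
  have "(\<Sum>k\<in>Poly_Mapping.keys p. Poly_Mapping.lookup p k * Poly_Mapping.lookup (g k) i) \<noteq> 0"
    using assms by (simp add: in_keys_iff lookup_lin_ext)
  then obtain k where "k \<in> Poly_Mapping.keys p" "Poly_Mapping.lookup p k * Poly_Mapping.lookup (g k) i \<noteq> 0"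
    using sum.not_neutral_contains_not_neutral by blast
  then show ?thesis
    using that by (simp add: in_keys_iff)
qed

section \<open>The module induced from a character, on polynomials\<close>

text \<open>
  Multisets over \<open>'b\<close> are the monomials in commuting variables indexed by \<open>'b\<close>, so
  \<open>'b multiset \<Rightarrow>\<^sub>0 complex\<close> is the space of polynomials in these variables.
\<close>
abbreviation lin :: "('k \<Rightarrow> 'm \<Rightarrow>\<^sub>0 complex) \<Rightarrow> ('k \<Rightarrow>\<^sub>0 complex) \<Rightarrow> 'm \<Rightarrow>\<^sub>0 complex" where
  "lin \<equiv> lin_ext coords_scale"

abbreviation monom :: "'m \<Rightarrow> 'm \<Rightarrow>\<^sub>0 complex" where
  "monom S \<equiv> Poly_Mapping.single S 1"

text \<open>
  A Lie algebra with basis \<open>'b\<close> and structure constants \<open>br\<close> is given, in which the basis vectors outside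
  \<open>N\<close> span a subalgebra with character \<open>\<chi>\<close>. The module induced from \<open>\<chi>\<close> lives on the polynomials in
  the variables from \<open>N\<close>. The order of \<open>'b\<close> is arbitrary; elements outside \<open>N\<close> always count as
  larger than those of \<open>N\<close>, since they have to be moved to the right until they meet the
  highest weight vector.
\<close>
locale induced_module =
  fixes N :: "'b::linorder set"
    and br :: "'b \<Rightarrow> 'b \<Rightarrow> 'b \<Rightarrow>\<^sub>0 complex"
    and \<chi> :: "'b \<Rightarrow> complex"
  assumes br_antisym: "br y x = - br x y"
    and br_jacobi: "lin (br x) (br y z) + lin (br y) (br z x) + lin (br z) (br x y) = 0"
    and br_closed: "x \<notin> N \<Longrightarrow> y \<notin> N \<Longrightarrow> z \<in> Poly_Mapping.keys (br x y) \<Longrightarrow> z \<notin> N"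
    and br_character: "x \<notin> N \<Longrightarrow> y \<notin> N \<Longrightarrow> lin_ext (*) \<chi> (br x y) = 0"
begin

text \<open>
  In this case \<open>x\<close> times the ordered monomial \<open>S\<close> is an ordered monomial already.
\<close>
definition front :: "'b \<Rightarrow> 'b multiset \<Rightarrow> bool" where
  "front x S \<longleftrightarrow> x \<in> N \<and> (\<forall>y\<in>#S. x \<le> y)"

text \<open>
  The leading term of \<open>x\<close> applied to \<open>S\<close>. It vanishes if \<open>x \<notin> N\<close>, since then the length does not
  grow.
\<close>
definition lead :: "'b \<Rightarrow> 'b multiset \<Rightarrow> 'b multiset \<Rightarrow>\<^sub>0 complex" where
  "lead x S = (if x \<in> N \<and> set_mset S \<subseteq> N then monom (add_mset x S) else 0)"

text \<open>
  The action has to satisfy \<open>x y R = y x R + [x, y] R\<close> when \<open>y\<close> may stand in front of \<open>R\<close> and \<open>x\<close> may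
  not stand in front of \<open>y R\<close>. Splitting off the leading term of \<open>x R\<close> makes this a recursion on
  the length: the remainder of \<open>x R\<close> is no longer than \<open>R\<close>, and \<open>y\<close> times the leading term of \<open>x R\<close> is just the
  leading term of \<open>x y R\<close>. So \<open>low n\<close> is the remainder of the action on monomials of length at most
  \<open>n\<close>. The value 0 on all monomials with variables outside \<open>N\<close> makes the module axioms
  trivial there, so that they hold without a side condition.
\<close>
primrec low :: "nat \<Rightarrow> 'b \<Rightarrow> 'b multiset \<Rightarrow> 'b multiset \<Rightarrow>\<^sub>0 complex" where
  "low 0 x S = (if S = {#} \<and> x \<notin> N then Poly_Mapping.single {#} (\<chi> x) else 0)"
| "low (Suc n) x S =
     (if size S \<le> n then low n x S
      else if size S = Suc n \<and> set_mset S \<subseteq> N \<and> \<not> front x S then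
        let y = Min (set_mset S); R = S - {#y#} in
        lin (\<lambda>T. lead y T + low n y T) (low n x R) + lin (\<lambda>z. lead z R + low n z R) (br x y)
      else 0)"

definition act :: "'b \<Rightarrow> 'b multiset \<Rightarrow> 'b multiset \<Rightarrow>\<^sub>0 complex" where
  "act x S = lead x S + low (size S) x S"

abbreviation op :: "'b \<Rightarrow> ('b multiset \<Rightarrow>\<^sub>0 complex) \<Rightarrow> 'b multiset \<Rightarrow>\<^sub>0 complex" where
  "op x \<equiv> lin (act x)"

abbreviation ops :: "('b \<Rightarrow>\<^sub>0 complex) \<Rightarrow> ('b multiset \<Rightarrow>\<^sub>0 complex) \<Rightarrow> 'b multiset \<Rightarrow>\<^sub>0 complex" where
  "ops q v \<equiv> lin (\<lambda>z. op z v) q"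

lemma low_stable: "size S \<le> n \<Longrightarrow> low n x S = low (size S) x S"
proof (induction n)
  case (Suc n)
  show ?case
  proof (cases "size S = Suc n")
    case False
    then have "size S \<le> n" using Suc.prems by simp
    then show ?thesis using Suc.IH by simp
  qed simp
qed simp

lemma act_eq_low: "size S \<le> n \<Longrightarrow> lead x S + low n x S = act x S"
  unfolding act_def by (subst low_stable[of S n]) simp_all

lemma size_lead: "T \<in> Poly_Mapping.keys (lead x S) \<Longrightarrow> size T = Suc (size S)"
  by (simp add: lead_def split: if_splits)

lemma size_low: "size S \<le> n \<Longrightarrow> T \<in> Poly_Mapping.keys (low n x S) \<Longrightarrow> size T \<le> size S"
proof (induction n arbitrary: x S T)
  case 0
  then show ?case by (simp split: if_splits)
next
  case (Suc n)
  have act: "size T \<le> Suc n" if "size R \<le> n" "T \<in> Poly_Mapping.keys (lead z R + low n z R)" for T R z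
    using keys_add_cases[OF that(2)] size_lead[of T z R] Suc.IH[of R T z] that(1) by auto
  show ?case
  proof (cases "size S \<le> n")
    case True
    then show ?thesis using Suc by simp
  next
    case False
    with Suc.prems have S: "size S = Suc n" by simp
    define y where "y = Min (set_mset S)"
    define R where "R = S - {#y#}"
    have "S \<noteq> {#}" using S by auto
    then have "y \<in># S" by (simp add: y_def)
    then have R: "size R = n" using S by (simp add: R_def size_Diff_singleton)
    have "T \<in> Poly_Mapping.keys (lin (\<lambda>T. lead y T + low n y T) (low n x R) + lin (\<lambda>z. lead z R + low n z R) (br x y))"
      using Suc.prems(2) False by (simp add: Let_def y_def R_def split: if_splits)
    from keys_add_cases[OF this] show ?thesis
    proof
      assume "T \<in> Poly_Mapping.keys (lin (\<lambda>T. lead y T + low n y T) (low n x R))"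
      then obtain T' where "T' \<in> Poly_Mapping.keys (low n x R)" "T \<in> Poly_Mapping.keys (lead y T' + low n y T')"
        by (rule keys_lin_ext)
      then show ?thesis
        using act[of T' T y] Suc.IH[of R T' x] R S by simp
    next
      assume "T \<in> Poly_Mapping.keys (lin (\<lambda>z. lead z R + low n z R) (br x y))"
      then obtain z where "T \<in> Poly_Mapping.keys (lead z R + low n z R)"
        by (rule keys_lin_ext)
      then show ?thesis
        using act[of R T z] R S by simp
    qed
  qed
qed

lemma act_outside: "\<not> set_mset S \<subseteq> N \<Longrightarrow> act x S = 0"
proof -
  assume S: "\<not> set_mset S \<subseteq> N"
  then have "low n x S = 0" for n
    by (induction n) auto
  then show "act x S = 0"
    using S by (simp add: act_def lead_def)
qed

lemma act_front: "front x S \<Longrightarrow> set_mset S \<subseteq> N \<Longrightarrow> act x S = monom (add_mset x S)"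
  by (cases "size S") (auto simp: act_def lead_def front_def)

lemma act_empty: "x \<notin> N \<Longrightarrow> act x {#} = Poly_Mapping.single {#} (\<chi> x)"
  by (simp add: act_def lead_def)

text \<open>
  This is the intended recursion, with the bookkeeping by depth and remainder removed.
\<close>
lemma act_add_mset:
  assumes S: "set_mset S \<subseteq> N" and y: "front y S" and x: "\<not> (x \<in> N \<and> x \<le> y)"
  shows "act x (add_mset y S) = op y (act x S) + lin (\<lambda>z. act z S) (br x y)"
proof -
  have [simp]: "y \<in> N" using y by (simp add: front_def)
  have Min: "Min (insert y (set_mset S)) = y"
    using y by (intro Min_eqI) (auto simp: front_def)
  have "low (Suc (size S)) x (add_mset y S) = lin (\<lambda>T. lead y T + low (size S) y T) (low (size S) x S) +
      lin (\<lambda>z. lead z S + low (size S) z S) (br x y)"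
    using S x by (subst low.simps(2)) (auto simp: Let_def Min front_def)
  also have "lin (\<lambda>T. lead y T + low (size S) y T) (low (size S) x S) = op y (low (size S) x S)"
    using size_low[OF order.refl] by (intro poly.lin_ext_cong act_eq_low) blast
  also have "lin (\<lambda>z. lead z S + low (size S) z S) (br x y) = lin (\<lambda>z. act z S) (br x y)"
    by (simp add: act_def)
  finally have low: "low (Suc (size S)) x (add_mset y S) =
      op y (low (size S) x S) + lin (\<lambda>z. act z S) (br x y)" .
  have lead: "lead x (add_mset y S) = op y (lead x S)"
  proof (cases "x \<in> N")
    case True
    then have "front y (add_mset x S)" using x y by (auto simp: front_def)
    then show ?thesis using True S by (simp add: lead_def act_front add_mset_commute)
  qed (simp add: lead_def)
  have "act x (add_mset y S) = lead x (add_mset y S) + low (Suc (size S)) x (add_mset y S)"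
    by (simp only: act_def size_add_mset)
  also have "\<dots> = op y (lead x S + low (size S) x S) + lin (\<lambda>z. act z S) (br x y)"
    by (simp only: low lead poly.lin_ext_add add.assoc)
  finally show ?thesis
    by (simp only: act_def[of x S])
qed

end

context induced_module
begin

lemma op_monom: "op x (monom S) = act x S"
  by simp

lemma op_op: "op x (op y v) = lin (\<lambda>S. op x (act y S)) v"
  by (rule poly.lin_ext_lin_ext)

lemma ops_eq: "ops q v = lin (\<lambda>S. lin (\<lambda>z. act z S) q) v"
  unfolding lin_ext_def coords.scale_sum_right by (subst sum.swap) (simp add: mult.commute)

lemma op_ops:
  assumes "\<And>z. op x (op z v) - op z (op x v) = ops (br x z) v"
  shows "op x (ops q v) = ops q (op x v) + ops (lin (br x) q) v"
proof -
  have "op x (ops q v) = lin (\<lambda>z. op x (op z v)) q"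
    by (rule poly.lin_ext_lin_ext)
  also have "\<dots> = lin (\<lambda>z. op z (op x v) + ops (br x z) v) q"
    using assms by (intro poly.lin_ext_cong) (simp add: algebra_simps)
  also have "\<dots> = ops q (op x v) + ops (lin (br x) q) v"
    by (simp only: poly.lin_ext_fun_add poly.lin_ext_lin_ext)
  finally show ?thesis .
qed

lemma commutator_linear:
  assumes "\<And>S. S \<in> Poly_Mapping.keys v \<Longrightarrow> op x (act y S) - op y (act x S) = lin (\<lambda>z. act z S) (br x y)"
  shows "op x (op y v) - op y (op x v) = ops (br x y) v"
  unfolding op_op ops_eq[where v = v] poly.lin_ext_fun_diff[symmetric] using assms by (rule poly.lin_ext_cong)

lemma commutator_front:
  assumes S: "set_mset S \<subseteq> N" and y: "front y S" and x: "\<not> (x \<in> N \<and> x \<le> y)"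
  shows "op x (act y S) - op y (act x S) = lin (\<lambda>z. act z S) (br x y)"
  using act_add_mset[OF S y x] S y by (simp add: act_front)

lemma commutator_swap:
  assumes "op x (act y S) - op y (act x S) = lin (\<lambda>z. act z S) (br x y)"
  shows "op y (act x S) - op x (act y S) = lin (\<lambda>z. act z S) (br y x)"
  using assms by (subst br_antisym) (simp add: poly.lin_ext_uminus algebra_simps)

lemma br_self: "br x x = 0"
proof (rule poly_mapping_eqI)
  fix k
  show "Poly_Mapping.lookup (br x x) k = Poly_Mapping.lookup 0 k"
    using arg_cong[OF br_antisym[of x x], of "\<lambda>p. Poly_Mapping.lookup p k"] by simp
qed

text \<open>
  The module axiom, which is the core of the Poincare-Birkhoff-Witt theorem; the induction is the
  classical one. If \<open>x\<close> or \<open>y\<close> may stand in front of \<open>S\<close>, then the relation is the defining recursion.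
  Otherwise write \<open>S = m R\<close> with the least variable \<open>m\<close>. Both \<open>x y S\<close> and \<open>y x S\<close>
  can be expanded by moving \<open>m\<close> to the front, which uses shorter monomials or monomials that \<open>m\<close>
  may stand in front of. The mixed terms cancel in the difference, and the Jacobi identity combines
  what is left. For the empty monomial, the relation says that \<open>\<chi>\<close> is a character.
\<close>
lemma commutator:
  "op x (act y S) - op y (act x S) = lin (\<lambda>z. act z S) (br x y)"
proof (induction "size S" arbitrary: x y S rule: less_induct)
  case less
  show ?case
  proof (cases "set_mset S \<subseteq> N")
    case False
    then show ?thesis by (simp add: act_outside)
  next
    case S: True
    have front: "op x (act y T) - op y (act x T) = lin (\<lambda>z. act z T) (br x y)"
      if T: "set_mset T \<subseteq> N" and "front x T \<or> front y T" for x y T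
    proof (cases "x = y")
      case True
      then show ?thesis by (simp add: br_self)
    next
      case False
      from that(2) show ?thesis
      proof
        assume x: "front x T"
        show ?thesis
        proof (cases "y \<in> N \<and> y \<le> x")
          case True
          then have "front y T" using x by (auto simp: front_def)
          (* the roles of x and y can be interchanged, since y < x *)
          then show ?thesis using True False by (intro commutator_front[OF T]) auto
        qed (rule commutator_swap[OF commutator_front[OF T x]])
      next
        assume y: "front y T"
        show ?thesis
        proof (cases "x \<in> N \<and> x \<le> y")
          case True
          then have "front x T" using y by (auto simp: front_def)
          then show ?thesis using True False by (intro commutator_swap[OF commutator_front[OF T]]) auto
        qed (intro commutator_front[OF T y])
      qed
    qed
    show ?thesis
    proof (cases "front x S \<or> front y S")
      case True
      then show ?thesis using front[OF S] by blast
    next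
      case nofront: False
      show ?thesis
      proof (cases "S = {#}")
        case True
        then have [simp]: "x \<notin> N" "y \<notin> N" using nofront by (auto simp: front_def)
        have "lin (\<lambda>z. act z {#}) (br x y) = lin (\<lambda>z. Poly_Mapping.single {#} (\<chi> z)) (br x y)"
          using br_closed[of x y] by (intro poly.lin_ext_cong) (simp add: act_empty)
        also have "\<dots> = Poly_Mapping.single {#} (lin_ext (*) \<chi> (br x y))"
          by (intro poly_mapping_eqI) (simp add: lookup_lin_ext lookup_single when_def lin_ext_def[of "(*)"])
        finally show ?thesis
          using True by (simp add: act_empty br_character coords_scale_single mult.commute)
      next
        case False
        define m where "m = Min (set_mset S)"
        define R where "R = S - {#m#}"
        have m: "m \<in># S" "\<And>z. z \<in># S \<Longrightarrow> m \<le> z" using False by (auto simp: m_def)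
        have SR: "S = add_mset m R" using m by (simp add: R_def)
        have R: "set_mset R \<subseteq> N" "front m R" "size R < size S" "m \<in> N"
          using S m(2) by (auto simp: SR front_def)
        have xm: "\<not> (x \<in> N \<and> x \<le> m)" "\<not> (y \<in> N \<and> y \<le> m)"
          using nofront m(2) by (auto simp: front_def intro: order_trans)
        have S_eq: "act m R = monom S" using act_front R SR by simp
        have small: "op u (op w v) - op w (op u v) = ops (br u w) v"
          if "\<And>T. T \<in> Poly_Mapping.keys v \<Longrightarrow> size T \<le> size R" for u w v
          using that R(3) by (intro commutator_linear less) fastforce
        have small_monom: "op u (op w (monom R)) - op w (op u (monom R)) = ops (br u w) (monom R)" for u w
          by (intro small) simp
        (* u w m R with m moved to the front; the two terms in the middle are symmetric in u and w
           and cancel in the commutator *)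
        have double: "op u (act w S) = op m (op u (act w R)) + ops (br u m) (act w R) +
            ops (br w m) (act u R) + ops (lin (br u) (br w m)) (monom R)"
          if u: "\<not> (u \<in> N \<and> u \<le> m)" and w: "\<not> (w \<in> N \<and> w \<le> m)" for u w
        proof -
          have "act w S = op m (act w R) + ops (br w m) (monom R)"
            using act_add_mset[OF R(1,2) w] by (simp add: SR)
          moreover have "op u (op m (act w R)) - op m (op u (act w R)) = ops (br u m) (act w R)"
          proof (rule commutator_linear)
            (* the leading monomial of w R is not shorter than S, but m may stand in front of it *)
            fix T
            assume "T \<in> Poly_Mapping.keys (act w R)"
            then have "T \<in> Poly_Mapping.keys (lead w R) \<or> T \<in> Poly_Mapping.keys (low (size R) w R)"
              unfolding act_def by (rule keys_add_cases)
            then show "op u (act m T) - op m (act u T) = lin (\<lambda>z. act z T) (br u m)"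
            proof
              assume "T \<in> Poly_Mapping.keys (lead w R)"
              then have T: "T = add_mset w R" "w \<in> N" by (auto simp: lead_def split: if_splits)
              then have "front m T" using R w by (auto simp: front_def)
              then show ?thesis using front[of T u m] T R by simp
            next
              assume "T \<in> Poly_Mapping.keys (low (size R) w R)"
              then have "size T \<le> size R" by (rule size_low[OF order.refl])
              then show ?thesis using R(3) by (intro less) simp
            qed
          qed
          moreover have "op u (ops (br w m) (monom R)) =
              ops (br w m) (act u R) + ops (lin (br u) (br w m)) (monom R)"
            using op_ops[of u "monom R", OF small_monom, of "br w m"] by (simp only: op_monom)
          ultimately show ?thesis
            by (simp only: poly.lin_ext_add) (simp add: algebra_simps)
        qed
        have "op m (ops (br x y) (monom R)) = ops (br x y) (act m R) + ops (lin (br m) (br x y)) (monom R)"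
          using op_ops[of m "monom R", OF small_monom, of "br x y"] by (simp only: op_monom)
        moreover have "op m (op x (act y R)) - op m (op y (act x R)) = op m (ops (br x y) (monom R))"
          using small_monom[of x y] by (simp only: op_monom poly.lin_ext_diff[symmetric])
        moreover have "lin (br m) (br x y) = - (lin (br x) (br y m) - lin (br y) (br x m))"
          using br_jacobi[of m x y] br_antisym[of m x]
          by (simp add: poly.lin_ext_uminus eq_neg_iff_add_eq_0 algebra_simps)
        ultimately have "op x (act y S) - op y (act x S) = ops (br x y) (act m R)"
          unfolding double[OF xm] double[OF xm(2,1)]
          by (simp add: poly.lin_ext_uminus poly.lin_ext_diff algebra_simps)
        then show ?thesis
          by (simp only: S_eq op_monom)
      qed
    qed
  qed
qed

corollary commutator_op: "op x (op y v) - op y (op x v) = ops (br x y) v"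
  by (intro commutator_linear commutator)

lemma keys_act_size:
  assumes "T \<in> Poly_Mapping.keys (act x S)"
  shows "size T \<le> Suc (size S)" "x \<notin> N \<Longrightarrow> size T \<le> size S"
proof -
  have "T \<in> Poly_Mapping.keys (lead x S) \<or> T \<in> Poly_Mapping.keys (low (size S) x S)"
    using assms unfolding act_def by (rule keys_add_cases)
  then show "size T \<le> Suc (size S)" "x \<notin> N \<Longrightarrow> size T \<le> size S"
    using size_lead[of T x S] size_low[OF order.refl, where T = T and x = x and S = S] by (auto simp: lead_def)
qed

lemma lookup_act_top:
  assumes "size S < size T"
  shows "Poly_Mapping.lookup (act x S) T = (if x \<in> N \<and> set_mset S \<subseteq> N \<and> T = add_mset x S then 1 else 0)"
proof -
  have "T \<notin> Poly_Mapping.keys (low (size S) x S)"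
    using assms size_low[OF order.refl, where T = T and x = x and S = S] by auto
  then have "Poly_Mapping.lookup (low (size S) x S) T = 0"
    by (simp add: in_keys_iff)
  then show ?thesis
    by (auto simp: act_def lookup_add lead_def lookup_single when_def)
qed

end

context induced_module
begin

text \<open>
  On leading terms \<open>p\<close> acts as the derivation that replaces a factor \<open>a\<close> of \<open>S\<close> by \<open>[p, a]\<close>. A
  variable \<open>b\<close> that does not occur in \<open>S\<close> can only come from such a replacement, so \<open>b R\<close> arises only
  from those factors \<open>a\<close> whose removal leaves \<open>R\<close>. The assumption \<open>\<chi> p = 0\<close> starts the
  induction: \<open>p\<close> annihilates the empty monomial.
\<close>
lemma lookup_act_fresh:
  assumes p: "p \<notin> N" "\<chi> p = 0" and b: "b \<in> N"
    and "set_mset S \<subseteq> N" "b \<notin># S" "set_mset R \<subseteq> N" "size S = Suc (size R)"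
  shows "Poly_Mapping.lookup (act p S) (add_mset b R) =
    (\<Sum>a\<in>#S. if S - {#a#} = R then Poly_Mapping.lookup (br p a) b else 0)"
  using assms(4-)
proof (induction S arbitrary: R rule: multiset_induct_min)
  case empty
  then show ?case by simp
next
  case (add y S)
  (* p y S = y (p S) + [p, y] S: the first summand accounts for the factors of S, the second for y *)
  have S: "set_mset S \<subseteq> N" "y \<in> N" "b \<noteq> y" "b \<notin># S" "size S = size R"
    using add.prems by auto
  have y: "front y S" using add by (auto simp: front_def)
  have "Poly_Mapping.lookup (op y (act p S)) (add_mset b R) =
    (\<Sum>T\<in>Poly_Mapping.keys (act p S). Poly_Mapping.lookup (act p S) T *
      (if set_mset T \<subseteq> N \<and> add_mset b R = add_mset y T then 1 else 0))"
    unfolding lookup_lin_ext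
  proof (intro sum.cong refl)
    fix T
    assume "T \<in> Poly_Mapping.keys (act p S)"
    then have "size T < size (add_mset b R)"
      using keys_act_size(2)[of T p S] p S by simp
    then show "Poly_Mapping.lookup (act p S) T * Poly_Mapping.lookup (act y T) (add_mset b R) =
      Poly_Mapping.lookup (act p S) T * (if set_mset T \<subseteq> N \<and> add_mset b R = add_mset y T then 1 else 0)"
      using S by (simp add: lookup_act_top)
  qed
  also have "\<dots> = (\<Sum>T\<in>Poly_Mapping.keys (act p S).
      if T = add_mset b (R - {#y#}) then (if y \<in># R then Poly_Mapping.lookup (act p S) T else 0) else 0)"
  proof (intro sum.cong refl)
    fix T
    have "(set_mset T \<subseteq> N \<and> add_mset b R = add_mset y T) \<longleftrightarrow> T = add_mset b (R - {#y#}) \<and> y \<in># R"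
    proof
      assume *: "set_mset T \<subseteq> N \<and> add_mset b R = add_mset y T"
      then have "y \<in># add_mset b R" by simp
      then have "y \<in># R" using S by auto
      moreover have "T = add_mset b R - {#y#}" using * by simp
      ultimately show "T = add_mset b (R - {#y#}) \<and> y \<in># R" using S(3) by simp
    next
      assume *: "T = add_mset b (R - {#y#}) \<and> y \<in># R"
      then show "set_mset T \<subseteq> N \<and> add_mset b R = add_mset y T"
        using add.prems(3) b by (auto simp: add_mset_commute dest: in_diffD)
    qed
    then show "Poly_Mapping.lookup (act p S) T * (if set_mset T \<subseteq> N \<and> add_mset b R = add_mset y T then 1 else 0) =
      (if T = add_mset b (R - {#y#}) then (if y \<in># R then Poly_Mapping.lookup (act p S) T else 0) else 0)"
      by auto
  qed
  also have "\<dots> = (if y \<in># R then Poly_Mapping.lookup (act p S) (add_mset b (R - {#y#})) else 0)"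
    by (auto simp: in_keys_iff)
  also have "\<dots> = (\<Sum>a\<in>#S. if add_mset y S - {#a#} = R then Poly_Mapping.lookup (br p a) b else 0)"
  proof (cases "y \<in># R")
    case True
    then obtain R' where R': "R = add_mset y R'" by (meson multi_member_split)
    have "Poly_Mapping.lookup (act p S) (add_mset b R') =
      (\<Sum>a\<in>#S. if S - {#a#} = R' then Poly_Mapping.lookup (br p a) b else 0)"
      using add.prems S R' by (intro add.IH) auto
    also have "\<dots> = (\<Sum>a\<in>#S. if add_mset y S - {#a#} = R then Poly_Mapping.lookup (br p a) b else 0)"
      by (intro arg_cong[of _ _ sum_mset] image_mset_cong) (simp add: R')
    finally show ?thesis using True R' by simp
  next
    case False
    then have "(if add_mset y S - {#a#} = R then Poly_Mapping.lookup (br p a) b else 0) = 0" if "a \<in># S" for a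
      using that by auto
    then have "(\<Sum>a\<in>#S. if add_mset y S - {#a#} = R then Poly_Mapping.lookup (br p a) b else 0) = (\<Sum>a\<in>#S. 0)"
      by (intro arg_cong[of _ _ sum_mset] image_mset_cong)
    then show ?thesis using False by simp
  qed
  finally have 1: "Poly_Mapping.lookup (op y (act p S)) (add_mset b R) =
    (\<Sum>a\<in>#S. if add_mset y S - {#a#} = R then Poly_Mapping.lookup (br p a) b else 0)" .
  have "Poly_Mapping.lookup (lin (\<lambda>z. act z S) (br p y)) (add_mset b R) =
    (\<Sum>z\<in>Poly_Mapping.keys (br p y). if z = b then (if S = R then Poly_Mapping.lookup (br p y) z else 0) else 0)"
    unfolding lookup_lin_ext
  proof (intro sum.cong refl)
    fix z
    have "(z \<in> N \<and> set_mset S \<subseteq> N \<and> add_mset b R = add_mset z S) \<longleftrightarrow> z = b \<and> S = R"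
      using S b by (auto simp: add_eq_conv_ex)
    then show "Poly_Mapping.lookup (br p y) z * Poly_Mapping.lookup (act z S) (add_mset b R) =
      (if z = b then (if S = R then Poly_Mapping.lookup (br p y) z else 0) else 0)"
      using S by (subst lookup_act_top) auto
  qed
  also have "\<dots> = (if S = R then Poly_Mapping.lookup (br p y) b else 0)"
    by (auto simp: in_keys_iff)
  finally show ?case
    using act_add_mset[OF S(1) y, of p] p 1 by (simp add: lookup_add)
qed

end

section \<open>Singular vectors on the polynomial model of the toroidal Verma module\<close>

text \<open>
  Any linear order on the basis serves for ordered monomials; a countable type has one.
\<close>
instance sl2_basis :: countable by countable_datatype
instance toroidal_basis :: countable by countable_datatype

instantiation toroidal_basis :: linorder
begin
definition less_eq_toroidal_basis :: "toroidal_basis \<Rightarrow> toroidal_basis \<Rightarrow> bool" where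
  "less_eq_toroidal_basis a b \<longleftrightarrow> to_nat a \<le> to_nat b"
definition less_toroidal_basis :: "toroidal_basis \<Rightarrow> toroidal_basis \<Rightarrow> bool" where
  "less_toroidal_basis a b \<longleftrightarrow> to_nat a < to_nat b"
instance
  by standard (auto simp: less_eq_toroidal_basis_def less_toroidal_basis_def)
end

definition neg_basis :: "toroidal_basis set" where
  "neg_basis = {Loop a m n |a m n. n < 0 \<or> n = 0 \<and> (m < 0 \<or> m = 0 \<and> a = F)}"

definition pos_basis :: "toroidal_basis set" where
  "pos_basis = {Loop a m n |a m n. n > 0 \<or> n = 0 \<and> (m > 0 \<or> m = 0 \<and> a = E)}"

definition affine_basis :: "toroidal_basis set" where
  "affine_basis = {Loop a m 0 |a m. True}"

text \<open>
  The character of the Borel subalgebra \<open>\<TT>\<^sub>+ \<oplus> \<hh>\<close> that defines the Verma module.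
\<close>
definition borel_char :: "(toroidal \<Rightarrow> complex) \<Rightarrow> toroidal_basis \<Rightarrow> complex" where
  "borel_char lam b = (if b \<in> pos_basis then 0 else lam (basis_vec b))"

lemma borel_char_pos: "b \<in> pos_basis \<Longrightarrow> borel_char lam b = 0"
  by (simp add: borel_char_def)

lemma Loop_in_basis [simp]:
  "Loop a m n \<in> neg_basis \<longleftrightarrow> n < 0 \<or> n = 0 \<and> (m < 0 \<or> m = 0 \<and> a = F)"
  "Loop a m n \<in> pos_basis \<longleftrightarrow> n > 0 \<or> n = 0 \<and> (m > 0 \<or> m = 0 \<and> a = E)"
  "Loop a m n \<in> affine_basis \<longleftrightarrow> n = 0"
  by (auto simp: neg_basis_def pos_basis_def affine_basis_def)

lemma not_Loop_in_basis [simp]: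
  "C1 \<notin> neg_basis" "C2 \<notin> neg_basis" "D1 \<notin> neg_basis" "D2 \<notin> neg_basis"
  "C1 \<notin> pos_basis" "C2 \<notin> pos_basis" "D1 \<notin> pos_basis" "D2 \<notin> pos_basis"
  "C1 \<notin> affine_basis" "C2 \<notin> affine_basis" "D1 \<notin> affine_basis" "D2 \<notin> affine_basis"
  by (auto simp: neg_basis_def pos_basis_def affine_basis_def)

lemma lookup_loop_coords:
  "Poly_Mapping.lookup (loop_coords x m n) (Loop c m' n') = (if m' = m \<and> n' = n then x c else 0)"
  "Poly_Mapping.lookup (loop_coords x m n) C1 = 0" "Poly_Mapping.lookup (loop_coords x m n) C2 = 0"
  "Poly_Mapping.lookup (loop_coords x m n) D1 = 0" "Poly_Mapping.lookup (loop_coords x m n) D2 = 0"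
  by (cases c; simp add: loop_coords_def lookup_add lookup_single when_def)+

lemma lin_basis_bracket: "lin (basis_bracket a) q = coords_lie (Poly_Mapping.single a 1) q"
  by (simp add: coords_lie_superset[of "{a}" _ "Poly_Mapping.keys q"] lin_ext_def)

text \<open>
  A central term needs opposite degrees; in the Borel subalgebra this means degree 0, where its
  coefficient vanishes. The Cartan subalgebra is abelian and acts on root vectors by scalars.
  So \<open>borel_char\<close> vanishes on the brackets and is a character.
\<close>
lemma keys_basis_bracket_nonneg:
  assumes "x \<notin> neg_basis" "y \<notin> neg_basis" "z \<in> Poly_Mapping.keys (basis_bracket x y)"
  shows "z \<in> pos_basis"
proof (cases "(x, y)" rule: basis_bracket.cases)
  case (1 a r1 r2 b s1 s2)
  then have "(r2 > 0 \<or> r2 = 0 \<and> (r1 > 0 \<or> r1 = 0 \<and> a \<noteq> F))" "(s2 > 0 \<or> s2 = 0 \<and> (s1 > 0 \<or> s1 = 0 \<and> b \<noteq> F))"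
    using assms(1,2) by auto
  moreover have "Poly_Mapping.lookup (basis_bracket (Loop a r1 r2) (Loop b s1 s2)) z \<noteq> 0"
    using 1 assms(3) by (simp add: in_keys_iff)
  ultimately show ?thesis
    by (cases z; cases a; cases b)
      (auto simp: lookup_loop_coords lookup_add lookup_single when_def split: if_splits)
qed (use assms in \<open>auto split: if_splits\<close>)

abbreviation tor_act :: "(toroidal \<Rightarrow> complex) \<Rightarrow> toroidal_basis \<Rightarrow> toroidal_basis multiset \<Rightarrow> toroidal_basis multiset \<Rightarrow>\<^sub>0 complex" where
  "tor_act lam \<equiv> induced_module.act neg_basis basis_bracket (borel_char lam)"

global_interpretation tor: induced_module neg_basis basis_bracket "borel_char lam" for lam
proof
  fix x y z :: toroidal_basis
  show "basis_bracket y x = - basis_bracket x y"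
    by (rule basis_bracket_antisym)
  show "lin (basis_bracket x) (basis_bracket y z) + lin (basis_bracket y) (basis_bracket z x) +
      lin (basis_bracket z) (basis_bracket x y) = 0"
    unfolding lin_basis_bracket by (rule coords_jacobi_basis)
  assume xy: "x \<notin> neg_basis" "y \<notin> neg_basis"
  show "z \<notin> neg_basis" if "z \<in> Poly_Mapping.keys (basis_bracket x y)"
    using keys_basis_bracket_nonneg[OF xy that] by (cases z) auto
  show "lin_ext (*) (borel_char lam) (basis_bracket x y) = 0"
    using keys_basis_bracket_nonneg[OF xy] by (simp add: lin_ext_def borel_char_pos)
qed

text \<open>
  Commuting \<open>a(r,1)\<close> past a factor of \<open>t\<^sub>2\<close>-degree 0 leaves an element of \<open>t\<^sub>2\<close>-degree 1, without a
  central term; so it arrives at the highest weight vector as an element of \<open>\<TT>\<^sub>+\<close>.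
\<close>
lemma degree_one_kills_affine_monomial:
  assumes "set_mset S \<subseteq> neg_basis \<inter> affine_basis"
  shows "tor_act lam (Loop a r 1) S = 0"
  using assms
proof (induction S arbitrary: a r rule: multiset_induct_min)
  case empty
  then show ?case by (simp add: tor.act_empty borel_char_pos)
next
  case (add y S)
  then have "set_mset S \<subseteq> neg_basis" "tor.front y S" by (auto simp: tor.front_def)
  then have "tor_act lam (Loop a r 1) (add_mset y S) =
      lin (tor_act lam y) (tor_act lam (Loop a r 1) S) + lin (\<lambda>z. tor_act lam z S) (basis_bracket (Loop a r 1) y)"
    by (rule tor.act_add_mset) simp
  also have "lin (\<lambda>z. tor_act lam z S) (basis_bracket (Loop a r 1) y) = lin (\<lambda>_. 0) (basis_bracket (Loop a r 1) y)"
  proof (rule poly.lin_ext_cong)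
    fix z
    assume z: "z \<in> Poly_Mapping.keys (basis_bracket (Loop a r 1) y)"
    obtain b m where "y = Loop b m 0" using add.prems by (cases y) auto
    then obtain c where "z = Loop c (r + m) 1"
      using z by (cases z) (auto simp: in_keys_iff lookup_loop_coords split: if_splits)
    then show "tor_act lam z S = 0" using add by auto
  qed
  finally show ?case using add by simp
qed

text \<open>
  Each of \<open>ad e\<close> and \<open>ad f\<close> sends two of the basis vectors to multiples of distinct basis vectors
  and the third one to 0, and no basis vector is annihilated by both.
\<close>
lemma sl2_separating_coordinate:
  obtains y d where "\<And>c'. sl2_bracket y c' d \<noteq> 0 \<longleftrightarrow> c' = c"
proof -
  have "\<exists>y d. \<forall>c'. (sl2_bracket y c' d \<noteq> 0) = (c' = c)"
  proof (cases c)
    case E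
    have "(sl2_bracket F c' H \<noteq> 0) = (c' = E)" for c' by (cases c') auto
    then show ?thesis using E by blast
  next
    case F
    have "(sl2_bracket E c' H \<noteq> 0) = (c' = F)" for c' by (cases c') auto
    then show ?thesis using F by blast
  next
    case H
    have "(sl2_bracket E c' E \<noteq> 0) = (c' = H)" for c' by (cases c') auto
    then show ?thesis using H by blast
  qed
  then show ?thesis using that by blast
qed

text \<open>
  The fresh factor argument. Monomials with a variable outside \<open>neg_basis\<close> are zero for the action, which is why the
  conclusion is restricted to the other ones.
\<close>
lemma affine_if_degree_one_kills:
  assumes kill: "\<And>a r. lin (tor_act lam (Loop a r 1)) w = 0"
    and S: "S \<in> Poly_Mapping.keys w" "set_mset S \<subseteq> neg_basis"
  shows "set_mset S \<subseteq> affine_basis"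
proof (rule ccontr)
  assume not_affine: "\<not> set_mset S \<subseteq> affine_basis"
  define B where "B = {S \<in> Poly_Mapping.keys w. set_mset S \<subseteq> neg_basis \<and> \<not> set_mset S \<subseteq> affine_basis}"
  have B: "finite B" "S \<in> B" using S not_affine by (auto simp: B_def)
  then have "Max (size ` B) \<in> size ` B" by (intro Max_in) auto
  then obtain S where S: "S \<in> B" "size S = Max (size ` B)" by auto
  then have max: "\<And>T. T \<in> B \<Longrightarrow> size T \<le> size S" using B by simp
  from S(1) obtain a where a: "a \<in># S" "a \<in> neg_basis" "a \<notin> affine_basis" by (auto simp: B_def)
  then obtain c m n where an: "a = Loop c m n" "n < 0" by (cases a) auto
  obtain y d where yd: "\<And>c'. sl2_bracket y c' d \<noteq> 0 \<longleftrightarrow> c' = c" using sl2_separating_coordinate by metis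
  define A where "A = (\<Union>T\<in>Poly_Mapping.keys w. set_mset T)"
  (* if n = - 1, then the new factor has t2-degree 0 and needs a negative t1-degree *)
  have "infinite ((\<lambda>r. Loop d (r + m) (1 + n)) ` {..< - m})"
    by (subst finite_image_iff) (auto simp: inj_on_def infinite_Iio)
  moreover have "finite A" by (simp add: A_def)
  ultimately obtain r where r: "r < - m" "Loop d (r + m) (1 + n) \<notin> A"
    by (metis (no_types, lifting) finite_subset image_subsetI lessThan_iff)
  define b where "b = Loop d (r + m) (1 + n)"
  define R where "R = S - {#a#}"
  define p where "p = Loop y r 1"
  have SR: "S = add_mset a R" using a by (simp add: R_def)
  have b: "b \<in> neg_basis" "b \<notin> A" using r an by (auto simp: b_def)
  have p: "p \<notin> neg_basis" "borel_char lam p = 0" by (auto simp: p_def borel_char_pos)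
  have br: "Poly_Mapping.lookup (basis_bracket p a') b \<noteq> 0 \<longleftrightarrow> a' = a" if "a' \<in> neg_basis" for a'
    using that r yd by (cases a') (auto simp: p_def b_def an lookup_loop_coords lookup_add lookup_single when_def)
  have fresh: "Poly_Mapping.lookup (tor_act lam p T) (add_mset b R) =
      (\<Sum>a'\<in>#T. if T - {#a'#} = R then Poly_Mapping.lookup (basis_bracket p a') b else 0)"
    if "T \<in> B" "size T = size S" for T
    using p b that S(1) by (intro tor.lookup_act_fresh) (auto simp: A_def B_def SR)
  have other: "Poly_Mapping.lookup (tor_act lam p T) (add_mset b R) = 0" if T: "T \<in> Poly_Mapping.keys w" "T \<noteq> S" for T
  proof (cases "T \<in> B")
    case False
    then have "tor_act lam p T = 0"
      using T degree_one_kills_affine_monomial[of T lam y r] tor.act_outside[of T lam p] by (auto simp: B_def p_def)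
    then show ?thesis by simp
  next
    case TB: True
    show ?thesis
    proof (cases "size T = size S")
      case True
      have "(if T - {#a'#} = R then Poly_Mapping.lookup (basis_bracket p a') b else 0) = 0" if "a' \<in># T" for a'
      proof (cases "a' = a")
        case True
        then have "T - {#a'#} \<noteq> R" using insert_DiffM[OF that] T(2) SR by auto
        then show ?thesis by simp
      next
        case False
        then show ?thesis using that br[of a'] TB by (auto simp: B_def)
      qed
      then have "(\<Sum>a'\<in>#T. if T - {#a'#} = R then Poly_Mapping.lookup (basis_bracket p a') b else 0) = (\<Sum>a'\<in>#T. 0)"
        by (intro arg_cong[of _ _ sum_mset] image_mset_cong)
      then show ?thesis using fresh[OF TB True] by simp
    next
      case False
      then have "size T < size (add_mset b R)" using max[OF TB] by (simp add: SR)
      then show ?thesis using p by (simp add: tor.lookup_act_top)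
    qed
  qed
  have "Poly_Mapping.lookup (tor_act lam p S) (add_mset b R) =
      (\<Sum>a'\<in>#S. if a' = a then Poly_Mapping.lookup (basis_bracket p a) b else 0)"
    unfolding fresh[OF S(1) refl]
  proof (intro arg_cong[of _ _ sum_mset] image_mset_cong)
    fix a'
    assume "a' \<in># S"
    then show "(if S - {#a'#} = R then Poly_Mapping.lookup (basis_bracket p a') b else 0) =
        (if a' = a then Poly_Mapping.lookup (basis_bracket p a) b else 0)"
      using br[of a'] S(1) by (auto simp: B_def R_def)
  qed
  also have "\<dots> = of_nat (count S a) * Poly_Mapping.lookup (basis_bracket p a) b"
    by (simp add: sum_mset_delta mult.commute)
  also have "\<dots> \<noteq> 0" using br a by simp
  finally have nz: "Poly_Mapping.lookup (tor_act lam p S) (add_mset b R) \<noteq> 0" .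
  have "0 = Poly_Mapping.lookup (lin (tor_act lam p) w) (add_mset b R)"
    using kill by (simp add: p_def)
  also have "\<dots> = (\<Sum>T\<in>Poly_Mapping.keys w. if T = S then Poly_Mapping.lookup w S * Poly_Mapping.lookup (tor_act lam p S) (add_mset b R) else 0)"
    unfolding lookup_lin_ext using other by (intro sum.cong) auto
  also have "\<dots> = Poly_Mapping.lookup w S * Poly_Mapping.lookup (tor_act lam p S) (add_mset b R)"
    using S(1) by (simp add: B_def)
  finally show False using nz S(1) by (simp add: B_def in_keys_iff)
qed

section \<open>Representations of the universal enveloping algebra\<close>
lemma finite_support_induct [case_names single sum]:
  fixes p :: "'k \<Rightarrow>\<^sub>0 complex"
  assumes single: "\<And>k c. P (Poly_Mapping.single k c)" and sum: "\<And>p q. P p \<Longrightarrow> P q \<Longrightarrow> P (p + q)"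
  shows "P p"
proof -
  have "P (\<Sum>k\<in>A. Poly_Mapping.single k (Poly_Mapping.lookup p k))" for A
    by (induction A rule: infinite_finite_induct) (use single[of undefined 0] in \<open>simp_all add: assms\<close>)
  then have "P (lin_ext coords_scale (\<lambda>k. Poly_Mapping.single k 1) p)"
    by (simp add: lin_ext_def coords_scale_single)
  then show ?thesis by (simp only: lin_ext_id)
qed

interpretation uea: complex_space uea_scale ..

lemma uea_incl_add: "uea_incl (x + y) = uea_incl x + uea_incl y"
  by transfer (use uea_ideal.ideal_gen[OF rel_add, of 1 _ _ 1] in \<open>simp add: diff_diff_add\<close>)

lemma uea_incl_scale: "uea_incl (c *\<^sub>C x) = uea_scale c (uea_incl x)"
  by transfer (use uea_ideal.ideal_gen[OF rel_scale, of 1 _ _ 1] in simp)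

lemma uea_incl_lie: "uea_incl (lie x y) = uea_incl x * uea_incl y - uea_incl y * uea_incl x"
proof -
  have "uea_incl x * uea_incl y - uea_incl y * uea_incl x = uea_incl (lie x y)"
    by transfer (use uea_ideal.ideal_gen[OF rel_lie, of 1 _ _ 1] in simp)
  then show ?thesis by simp
qed

lemma uea_scale_mult_left: "uea_scale c u * v = uea_scale c (u * v)"
  by transfer (simp add: mult.assoc ideal_zero)

lemma uea_induct [case_names one incl add scale]:
  assumes "P 1" "\<And>x u. P u \<Longrightarrow> P (uea_incl x * u)" "\<And>u v. P u \<Longrightarrow> P v \<Longrightarrow> P (u + v)"
    "\<And>c u. P u \<Longrightarrow> P (uea_scale c u)"
  shows "P (u :: 'g::complex_lie_algebra uea)"
proof (induction u rule: uea.abs_induct)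
  case (1 p)
  have word: "P (abs_uea (Poly_Mapping.single xs 1))" for xs :: "'g list"
  proof (induction xs)
    case Nil
    then show ?case using assms(1) by (simp add: one_uea_def single_one flip: zero_list_def)
  next
    case (Cons x xs)
    have "Poly_Mapping.single (x # xs) (1::complex) = free_gen x * Poly_Mapping.single xs 1"
      by (simp add: mult_single plus_list_def)
    then have "abs_uea (Poly_Mapping.single (x # xs) 1) = uea_incl x * abs_uea (Poly_Mapping.single xs 1)"
      by (simp add: uea_incl_def times_uea.abs_eq)
    then show ?case using assms(2) Cons by simp
  qed
  show ?case
  proof (induction p rule: finite_support_induct)
    case (single xs c)
    have "Poly_Mapping.single xs c = free_const c * Poly_Mapping.single xs 1"
      by (simp add: mult_single)
    then have "abs_uea (Poly_Mapping.single xs c) = uea_scale c (abs_uea (Poly_Mapping.single xs 1))"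
      by (simp add: uea_scale.abs_eq)
    then show ?case using assms(4) word by simp
  next
    case (sum p q)
    then show ?case using assms(3) by (simp flip: plus_uea.abs_eq)
  qed
qed

locale lie_module = complex_space s for s :: "complex \<Rightarrow> 'v \<Rightarrow> 'v::ab_group_add" +
  fixes rho :: "'g::complex_lie_algebra \<Rightarrow> 'v \<Rightarrow> 'v"
  assumes rho_add_left: "rho (x + y) v = rho x v + rho y v"
    and rho_scale_left: "rho (c *\<^sub>C x) v = s c (rho x v)"
    and rho_add: "rho x (v + w) = rho x v + rho x w"
    and rho_scale: "rho x (s c v) = s c (rho x v)"
    and rho_lie: "rho (lie x y) v = rho x (rho y v) - rho y (rho x v)"
begin

definition free_act :: "('g list \<Rightarrow>\<^sub>0 complex) \<Rightarrow> 'v \<Rightarrow> 'v" where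
  "free_act p v = lin_ext s (\<lambda>xs. foldr rho xs v) p"

definition uea_act :: "'g uea \<Rightarrow> 'v \<Rightarrow> 'v" where
  "uea_act u = free_act (rep_uea u)"

lemma rho_zero_left: "rho 0 v = 0"
  using rho_add_left[of 0 0 v] by simp

lemma foldr_rho_add: "foldr rho xs (v + w) = foldr rho xs v + foldr rho xs w"
  by (induction xs) (simp_all add: rho_add)

lemma foldr_rho_scale: "foldr rho xs (s c v) = s c (foldr rho xs v)"
  by (induction xs) (simp_all add: rho_scale)

lemma free_act_add_right: "free_act p (v + w) = free_act p v + free_act p w"
  by (simp add: free_act_def foldr_rho_add lin_ext_fun_add)

lemma free_act_scale_right: "free_act p (s c v) = s c (free_act p v)"
  by (simp add: free_act_def foldr_rho_scale lin_ext_fun_scale)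

lemma free_act_mult: "free_act (p * q) v = free_act p (free_act q v)"
proof (induction p rule: finite_support_induct)
  case (single xs c)
  show ?case
  proof (induction q rule: finite_support_induct)
    case (single ys d)
    then show ?case by (simp add: mult_single free_act_def plus_list_def foldr_rho_scale)
  next
    case (sum q r)
    then show ?case
      by (simp add: free_act_def lin_ext_add distrib_left foldr_rho_add scale_right_distrib)
  qed
next
  case (sum p q)
  then show ?case by (simp add: distrib_right free_act_def lin_ext_add)
qed

lemma free_act_relation: "r \<in> uea_relations \<Longrightarrow> free_act r v = 0"
proof (induction rule: uea_relations.induct)
  case (rel_add x y)
  then show ?case by (simp add: free_act_def lin_ext_diff rho_add_left)
next
  case (rel_scale c x)
  then show ?case by (simp add: free_act_def lin_ext_diff mult_single rho_scale_left)
next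
  case (rel_lie x y)
  then show ?case by (simp add: free_act_def lin_ext_diff mult_single plus_list_def rho_lie)
qed

lemma free_act_ideal: "p \<in> uea_ideal \<Longrightarrow> free_act p v = 0"
proof (induction rule: uea_ideal.induct)
  case (ideal_gen r p q)
  have "free_act p 0 = 0" using free_act_add_right[of p 0 0] by simp
  then show ?case using ideal_gen by (simp add: free_act_mult free_act_relation)
qed (simp add: free_act_def lin_ext_add)

lemma uea_act_abs: "uea_act (abs_uea p) v = free_act p v"
proof -
  have "abs_uea (rep_uea (abs_uea p)) = abs_uea p"
    by (rule Quotient3_abs_rep[OF Quotient3_uea])
  then have "free_act (rep_uea (abs_uea p) - p) v = 0"
    by (intro free_act_ideal) (simp add: uea.abs_eq_iff)
  then show ?thesis by (simp add: uea_act_def free_act_def lin_ext_diff)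
qed

lemma uea_act_one: "uea_act 1 v = v"
  by (simp add: one_uea_def uea_act_abs) (simp add: free_act_def zero_list_def flip: single_one)

lemma uea_act_incl: "uea_act (uea_incl x) v = rho x v"
  by (simp add: uea_incl_def uea_act_abs free_act_def)

lemma uea_act_add: "uea_act (u + w) v = uea_act u v + uea_act w v"
  by (induction u rule: uea.abs_induct, induction w rule: uea.abs_induct)
    (simp add: plus_uea.abs_eq uea_act_abs free_act_def lin_ext_add)

lemma uea_act_mult: "uea_act (u * w) v = uea_act u (uea_act w v)"
  by (induction u rule: uea.abs_induct, induction w rule: uea.abs_induct)
    (simp add: times_uea.abs_eq uea_act_abs free_act_mult)

lemma uea_act_scale: "uea_act (uea_scale c u) v = s c (uea_act u v)"
  by (induction u rule: uea.abs_induct)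
    (simp add: uea_scale.abs_eq uea_act_abs free_act_mult, simp add: free_act_def zero_list_def)

lemma uea_act_scale_right: "uea_act u (s c v) = s c (uea_act u v)"
  by (simp add: uea_act_def free_act_scale_right)

end

section \<open>Coordinates on the Verma module\<close>
lemma basis_expansion: "x = (\<Sum>b\<in>Poly_Mapping.keys (coords x). Poly_Mapping.lookup (coords x) b *\<^sub>C basis_vec b)"
proof -
  have sum: "coords (sum g A) = (\<Sum>b\<in>A. coords (g b))" for g :: "toroidal_basis \<Rightarrow> toroidal" and A
    by (induction A rule: infinite_finite_induct) (simp_all add: plus_toroidal.rep_eq zero_toroidal.rep_eq)
  have "coords x = lin (\<lambda>b. Poly_Mapping.single b 1) (coords x)"
    by (simp only: lin_ext_id)
  then show ?thesis
    by (simp add: sum scaleC_toroidal.rep_eq basis_vec.rep_eq lin_ext_def flip: coords_inject)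
qed

lemma uea_incl_expansion: "uea_incl x = lin_ext uea_scale (\<lambda>b. uea_incl (basis_vec b)) (coords x)"
proof -
  have "uea_incl (0 :: toroidal) = 0"
    using uea_incl_add[of 0 "0 :: toroidal"] by simp
  then have "uea_incl (sum g A) = (\<Sum>b\<in>A. uea_incl (g b))" for g :: "toroidal_basis \<Rightarrow> toroidal" and A
    by (induction A rule: infinite_finite_induct) (simp_all add: uea_incl_add)
  then show ?thesis
    by (subst basis_expansion) (simp add: uea_incl_scale lin_ext_def)
qed

lemma lin_ext_swap:
  "lin (\<lambda>a. lin (g a) q) p = lin (\<lambda>b. lin (\<lambda>a. g a b) p) q"
  unfolding lin_ext_def coords.scale_sum_right by (subst sum.swap) (simp add: mult.commute)

definition tor_rep :: "(toroidal \<Rightarrow> complex) \<Rightarrow> toroidal \<Rightarrow> (toroidal_basis multiset \<Rightarrow>\<^sub>0 complex) \<Rightarrow> toroidal_basis multiset \<Rightarrow>\<^sub>0 complex" where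
  "tor_rep lam x v = lin (\<lambda>b. lin (tor_act lam b) v) (coords x)"

global_interpretation tor_module: lie_module coords_scale "tor_rep lam" for lam
proof
  fix x y :: toroidal and c :: complex and v w :: "toroidal_basis multiset \<Rightarrow>\<^sub>0 complex"
  show "tor_rep lam (x + y) v = tor_rep lam x v + tor_rep lam y v"
    by (simp add: tor_rep_def plus_toroidal.rep_eq poly.lin_ext_add)
  show "tor_rep lam (c *\<^sub>C x) v = coords_scale c (tor_rep lam x v)"
    by (simp add: tor_rep_def scaleC_toroidal.rep_eq poly.lin_ext_scale)
  show "tor_rep lam x (v + w) = tor_rep lam x v + tor_rep lam x w"
    by (simp add: tor_rep_def poly.lin_ext_add poly.lin_ext_fun_add)
  show "tor_rep lam x (coords_scale c v) = coords_scale c (tor_rep lam x v)"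
    by (simp add: tor_rep_def poly.lin_ext_scale poly.lin_ext_fun_scale)
  let ?op = "\<lambda>b. lin (tor_act lam b)"
  define p q where "p = coords x" and "q = coords y"
  have "coords (lie x y) = lin (\<lambda>a. lin (basis_bracket a) q) p"
    by (simp add: lie_toroidal.rep_eq coords_lie_def lin_ext_def coords.scale_sum_right p_def q_def)
  then have "tor_rep lam (lie x y) v = lin (\<lambda>a. lin (\<lambda>b. lin (\<lambda>z. ?op z v) (basis_bracket a b)) q) p"
    by (simp only: tor_rep_def poly.lin_ext_lin_ext)
  also have "\<dots> = lin (\<lambda>a. lin (\<lambda>b. ?op a (?op b v)) q) p - lin (\<lambda>a. lin (\<lambda>b. ?op b (?op a v)) q) p"
    by (simp only: tor.commutator_op[symmetric] poly.lin_ext_fun_diff)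
  also have "lin (\<lambda>a. lin (\<lambda>b. ?op b (?op a v)) q) p = lin (\<lambda>b. lin (\<lambda>a. ?op b (?op a v)) p) q"
    by (rule lin_ext_swap)
  finally show "tor_rep lam (lie x y) v = tor_rep lam x (tor_rep lam y v) - tor_rep lam y (tor_rep lam x v)"
    by (simp only: tor_rep_def poly.lin_ext_lin_ext p_def q_def)
qed

lemma tor_rep_basis: "tor_rep lam (basis_vec b) v = lin (tor_act lam b) v"
  by (simp add: tor_rep_def basis_vec.rep_eq)

definition vacuum :: "toroidal_basis multiset \<Rightarrow>\<^sub>0 complex" where
  "vacuum = monom {#}"

lemma lin_ext_vacuum [simp]: "lin g vacuum = g {#}" "lin_ext uea_scale g' vacuum = g' {#}"
  unfolding vacuum_def by (simp_all only: poly.lin_ext_single uea.lin_ext_single coords.scale_one uea_vs.scale_one)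

lemma act_vacuum: "b \<notin> neg_basis \<Longrightarrow> tor_act lam b {#} = coords_scale (borel_char lam b) vacuum"
  unfolding vacuum_def coords_scale_single mult_1_right by (rule tor.act_empty)

abbreviation tor_uea_act :: "(toroidal \<Rightarrow> complex) \<Rightarrow> toroidal uea \<Rightarrow> (toroidal_basis multiset \<Rightarrow>\<^sub>0 complex) \<Rightarrow> toroidal_basis multiset \<Rightarrow>\<^sub>0 complex" where
  "tor_uea_act lam \<equiv> lie_module.uea_act coords_scale (tor_rep lam)"

text \<open>
  Applying an element of the enveloping algebra to the vacuum of the polynomial model realises the map
  from the Verma module to the model on representatives.
\<close>
definition verma_coords :: "(toroidal \<Rightarrow> complex) \<Rightarrow> toroidal uea \<Rightarrow> toroidal_basis multiset \<Rightarrow>\<^sub>0 complex" where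
  "verma_coords lam u = tor_uea_act lam u vacuum"

lemma loop_expansion: "loop x m n = x E *\<^sub>C e_loop m n + x F *\<^sub>C f_loop m n + x H *\<^sub>C h_loop m n"
  by (simp flip: coords_inject add: loop.rep_eq basis_vec.rep_eq plus_toroidal.rep_eq scaleC_toroidal.rep_eq loop_coords_def coords_scale_single add.assoc)

lemma toroidal_pos_kills: "x \<in> toroidal_pos \<Longrightarrow> tor_rep lam x vacuum = 0"
  unfolding toroidal_pos_def
proof (induction rule: lie_vs.span_induct_alt)
  case base
  then show ?case by (simp add: tor_module.rho_zero_left)
next
  case (step c x y)
  have basis: "tor_rep lam (basis_vec b) vacuum = 0" if "b \<in> pos_basis" for b
    using that by (cases b) (auto simp: tor_rep_basis act_vacuum borel_char_pos)
  from step(1) have "tor_rep lam x vacuum = 0"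
    by (auto simp: basis le_less loop_expansion tor_module.rho_add_left tor_module.rho_scale_left)
  then show ?case using step by (simp add: tor_module.rho_add_left tor_module.rho_scale_left)
qed

lemma cartan_eigen:
  assumes lam: "is_weight lam" and h: "h \<in> cartan"
  shows "tor_rep lam h vacuum = coords_scale (lam h) vacuum"
proof -
  have "h \<in> cartan \<and> tor_rep lam h vacuum = coords_scale (lam h) vacuum"
    using h unfolding cartan_def
  proof (induction rule: lie_vs.span_induct_alt)
    case base
    have 0: "(0::toroidal) \<in> cartan" unfolding cartan_def by (rule lie_vs.span_zero)
    then have "lam 0 = lam 0 + lam 0" using lam unfolding is_weight_def by (metis add_0)
    then show ?case using 0 unfolding cartan_def by (simp add: tor_module.rho_zero_left)
  next
    case (step c x y)
    have xy: "x \<in> cartan" "y \<in> cartan"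
      using step by (auto simp: cartan_def lie_vs.span_base)
    then have cx: "c *\<^sub>C x \<in> cartan" by (simp add: cartan_def lie_vs.span_scale)
    then have "lam (c *\<^sub>C x + y) = c * lam x + lam y"
      using lam xy by (simp add: is_weight_def)
    moreover have "c *\<^sub>C x + y \<in> cartan"
      using cx xy(2) unfolding cartan_def by (rule lie_vs.span_add)
    moreover have "tor_rep lam x vacuum = coords_scale (lam x) vacuum"
      using step(1) by (auto simp: tor_rep_basis act_vacuum borel_char_def)
    ultimately show ?case
      using step unfolding cartan_def
      by (simp add: tor_module.rho_add_left tor_module.rho_scale_left coords.scale_left_distrib)
  qed
  then show ?thesis by simp
qed

lemma borel_action_eigen:
  assumes lam: "is_weight lam" and b: "(b, t) \<in> borel_action lam"
  shows "verma_coords lam b = coords_scale t vacuum"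
  using b unfolding verma_coords_def
proof (induction rule: borel_action.induct)
  case (borel_pos x)
  then show ?case by (simp add: tor_module.uea_act_incl toroidal_pos_kills)
next
  case (borel_cartan h)
  then show ?case by (simp add: tor_module.uea_act_incl cartan_eigen[OF lam])
next
  case borel_one
  then show ?case by (simp add: tor_module.uea_act_one)
next
  case (borel_scale a s c)
  then show ?case by (simp add: tor_module.uea_act_scale)
next
  case (borel_add a s b t)
  then show ?case by (simp add: tor_module.uea_act_add coords.scale_left_distrib)
next
  case (borel_mult a s b t)
  then show ?case by (simp add: tor_module.uea_act_mult tor_module.uea_act_scale_right mult.commute)
qed

lemma verma_coords_rel:
  assumes lam: "is_weight lam" and u: "u \<in> verma_rel lam"
  shows "verma_coords lam u = 0"
  using u unfolding verma_rel_def
proof (induction rule: uea_vs.span_induct_alt)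
  case base
  then show ?case
    using tor_module.uea_act_add[of lam 0 0 "vacuum"] by (simp add: verma_coords_def)
next
  case (step c x y)
  then obtain u b t where x: "x = u * b - uea_scale t u" and b: "(b, t) \<in> borel_action lam"
    by blast
  have "verma_coords lam (x + uea_scale t u) = verma_coords lam (uea_scale t u)"
    using borel_action_eigen[OF lam b]
    by (simp add: x verma_coords_def tor_module.uea_act_mult tor_module.uea_act_scale_right tor_module.uea_act_scale)
  then have "verma_coords lam x = 0"
    by (simp add: verma_coords_def tor_module.uea_act_add)
  then show ?case
    using step by (simp add: verma_coords_def tor_module.uea_act_add tor_module.uea_act_scale)
qed

text \<open>
  The value 0 outside \<open>neg_basis\<close> matches the zero action of the model on such monomials.
\<close>
definition pbw_monomial :: "toroidal_basis multiset \<Rightarrow> toroidal uea" where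
  "pbw_monomial S = (if set_mset S \<subseteq> neg_basis
     then prod_list (map (\<lambda>b. uea_incl (basis_vec b)) (sorted_list_of_multiset S)) else 0)"

abbreviation pbw_sum :: "(toroidal_basis multiset \<Rightarrow>\<^sub>0 complex) \<Rightarrow> toroidal uea" where
  "pbw_sum \<equiv> lin_ext uea_scale pbw_monomial"

lemma verma_rel_uminus: "u \<in> verma_rel lam \<Longrightarrow> - u \<in> verma_rel lam"
  unfolding verma_rel_def by (rule uea_vs.span_neg)

lemma verma_rel_trans: "u - v \<in> verma_rel lam \<Longrightarrow> v - w \<in> verma_rel lam \<Longrightarrow> u - w \<in> verma_rel lam"
  using verma_rel_add[of "u - v" lam "v - w"] by simp

lemma verma_rel_lin_ext:
  assumes "\<And>k. k \<in> Poly_Mapping.keys p \<Longrightarrow> g k - h k \<in> verma_rel lam"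
  shows "lin_ext uea_scale g p - lin_ext uea_scale h p \<in> verma_rel lam"
  unfolding uea.lin_ext_fun_diff[symmetric]
  unfolding lin_ext_def verma_rel_def using assms unfolding verma_rel_def by (intro uea_vs.span_sum uea_vs.span_scale)

lemma mult_lin_ext: "u * lin_ext uea_scale g p = lin_ext uea_scale (\<lambda>k. u * g k) p"
  by (simp add: lin_ext_def sum_distrib_left mult_uea_scale_right)

lemma lin_ext_mult: "lin_ext uea_scale g p * u = lin_ext uea_scale (\<lambda>k. g k * u) p"
  by (simp add: lin_ext_def sum_distrib_right uea_scale_mult_left)

lemma pbw_monomial_front:
  assumes "tor.front b S" "set_mset S \<subseteq> neg_basis"
  shows "uea_incl (basis_vec b) * pbw_monomial S = pbw_monomial (add_mset b S)"
  using assms by (simp add: pbw_monomial_def tor.front_def insort_is_Cons)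

lemma nonneg_basis_in_borel_action:
  assumes "b \<notin> neg_basis"
  shows "(uea_incl (basis_vec b), borel_char lam b) \<in> borel_action lam"
proof (cases "b \<in> pos_basis")
  case True
  then obtain a m n where b: "b = Loop a m n" "n > 0 \<or> n = 0 \<and> (m > 0 \<or> m = 0 \<and> a = E)"
    by (auto simp: pos_basis_def)
  have loop: "basis_vec b = loop ((\<lambda>_. 0)(a := 1)) m n"
    using b(1) by (cases a) (simp_all add: loop_expansion lie_vs.scale_zero_left)
  have "basis_vec b \<in> {e_loop m 0 |m. m \<ge> 0} \<union> {f_loop m 0 |m. m \<ge> 1} \<union> {h_loop m 0 |m. m \<ge> 1} \<union>
      {loop x m n |x m n. n \<ge> 1}"
  proof (cases "n > 0")
    case True
    then have "n \<ge> 1" by simp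
    then show ?thesis unfolding loop by blast
  next
    case False
    then show ?thesis using b by (cases a) auto
  qed
  then have "basis_vec b \<in> toroidal_pos"
    unfolding toroidal_pos_def by (rule lie_vs.span_base)
  then show ?thesis using True by (simp add: borel_char_def borel_pos)
next
  case False
  then have "b \<in> {Loop H 0 0, C1, C2, D1, D2}"
    using assms by (cases b; cases "case b of Loop a _ _ \<Rightarrow> a") auto
  then have "basis_vec b \<in> cartan"
    unfolding cartan_def by (intro lie_vs.span_base) auto
  then show ?thesis using False by (simp add: borel_char_def borel_cartan)
qed

text \<open>
  The model was defined by straightening products of basis vectors, and every step of this
  straightening is an identity in the enveloping algebra modulo \<open>verma_rel lam\<close>. The induction therefore
  follows the recursion of the action.
\<close>
lemma basis_mult_pbw_monomial:
  "uea_incl (basis_vec b) * pbw_monomial S - pbw_sum (tor_act lam b S) \<in> verma_rel lam"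
proof (induction "size S" arbitrary: b S rule: less_induct)
  case less
  let ?b = "\<lambda>b. uea_incl (basis_vec b)"
  show ?case
  proof (cases "set_mset S \<subseteq> neg_basis")
    case False
    then show ?thesis by (simp add: tor.act_outside verma_rel_zero pbw_monomial_def)
  next
    case S: True
    show ?thesis
    proof (cases "tor.front b S")
      case True
      then show ?thesis by (simp add: tor.act_front S pbw_monomial_front verma_rel_zero)
    next
      case nofront: False
      show ?thesis
      proof (cases "S = {#}")
        case True
        then have b: "b \<notin> neg_basis" using nofront by (auto simp: tor.front_def)
        have "1 * ?b b - uea_scale (borel_char lam b) 1 \<in> verma_rel lam"
          unfolding verma_rel_def by (rule uea_vs.span_base) (use nonneg_basis_in_borel_action[OF b] in blast)
        then show ?thesis using True b by (simp add: act_vacuum uea.lin_ext_scale pbw_monomial_def)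
      next
        case False
        define y where "y = Min (set_mset S)"
        define R where "R = S - {#y#}"
        have y: "y \<in># S" "\<And>z. z \<in># S \<Longrightarrow> y \<le> z" using False by (auto simp: y_def)
        have SR: "S = add_mset y R" using y by (simp add: R_def)
        have R: "set_mset R \<subseteq> neg_basis" "tor.front y R" "size R < size S" "y \<in> neg_basis"
          using S y(2) by (auto simp: SR tor.front_def)
        have nle: "\<not> (b \<in> neg_basis \<and> b \<le> y)"
          using nofront y(2) by (auto simp: tor.front_def intro: order_trans)
        have "?b b * ?b y = ?b y * ?b b + lin_ext uea_scale ?b (basis_bracket b y)"
          using uea_incl_lie[of "basis_vec b" "basis_vec y"] uea_incl_expansion[of "lie (basis_vec b) (basis_vec y)"]
          by (simp add: lie_basis_vec of_coords_inverse algebra_simps)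
        then have "?b b * pbw_monomial S =
            ?b y * (?b b * pbw_monomial R) + lin_ext uea_scale ?b (basis_bracket b y) * pbw_monomial R"
          unfolding SR pbw_monomial_front[OF R(2,1), symmetric]
          by (simp only: distrib_right flip: mult.assoc)
        moreover have "?b y * (?b b * pbw_monomial R) - ?b y * pbw_sum (tor_act lam b R) \<in> verma_rel lam"
          using verma_rel_mult[OF less[OF R(3)]] by (simp add: right_diff_distrib)
        moreover have "?b y * pbw_sum (tor_act lam b R) - pbw_sum (lin (tor_act lam y) (tor_act lam b R)) \<in> verma_rel lam"
          unfolding mult_lin_ext uea.lin_ext_lin_ext
        proof (rule verma_rel_lin_ext)
          fix T
          assume "T \<in> Poly_Mapping.keys (tor_act lam b R)"
          then have "T \<in> Poly_Mapping.keys (tor.lead b R) \<or> T \<in> Poly_Mapping.keys (induced_module.low neg_basis basis_bracket (borel_char lam) (size R) b R)"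
            unfolding tor.act_def by (rule keys_add_cases)
          then show "?b y * pbw_monomial T - pbw_sum (tor_act lam y T) \<in> verma_rel lam"
          proof
            assume "T \<in> Poly_Mapping.keys (tor.lead b R)"
            then have T: "T = add_mset b R" "b \<in> neg_basis" by (auto simp: tor.lead_def split: if_splits)
            then have "tor.front y T" "set_mset T \<subseteq> neg_basis" using R nle by (auto simp: tor.front_def)
            then show ?thesis by (simp add: tor.act_front pbw_monomial_front verma_rel_zero)
          next
            assume "T \<in> Poly_Mapping.keys (induced_module.low neg_basis basis_bracket (borel_char lam) (size R) b R)"
            then have "size T \<le> size R" by (rule tor.size_low[OF order.refl])
            then show ?thesis using R(3) by (intro less) simp
          qed
        qed
        moreover have "lin_ext uea_scale ?b (basis_bracket b y) * pbw_monomial R -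
            pbw_sum (lin (\<lambda>z. tor_act lam z R) (basis_bracket b y)) \<in> verma_rel lam"
          unfolding lin_ext_mult uea.lin_ext_lin_ext by (intro verma_rel_lin_ext less R(3))
        ultimately show ?thesis
          unfolding SR tor.act_add_mset[OF R(1,2) nle]
          using verma_rel_trans verma_rel_add by (smt (verit) add_diff_add uea.lin_ext_add)
      qed
    qed
  qed
qed

lemma verma_coords_incl: "verma_coords lam (uea_incl x * u) = tor_rep lam x (verma_coords lam u)"
  by (simp add: verma_coords_def tor_module.uea_act_mult tor_module.uea_act_incl)

text \<open>
  Left multiplication by a basis vector preserves the span of the ordered monomials, which contains 1,
  and the model records the coefficients. In particular a vector with coordinates 0 is 0.
\<close>
lemma pbw_spanning: "u - pbw_sum (verma_coords lam u) \<in> verma_rel lam"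
proof (induction u rule: uea_induct)
  case one
  show ?case by (simp add: verma_coords_def tor_module.uea_act_one pbw_monomial_def verma_rel_zero)
next
  case (incl x u)
  let ?v = "verma_coords lam u"
  have "uea_incl x * u - uea_incl x * pbw_sum ?v \<in> verma_rel lam"
    using verma_rel_mult[OF incl] by (simp add: right_diff_distrib)
  moreover have "uea_incl x * pbw_sum ?v - pbw_sum (tor_rep lam x ?v) \<in> verma_rel lam"
  proof -
    have "uea_incl (basis_vec b) * pbw_sum ?v - pbw_sum (lin (tor_act lam b) ?v) \<in> verma_rel lam" for b
      unfolding mult_lin_ext uea.lin_ext_lin_ext by (intro verma_rel_lin_ext basis_mult_pbw_monomial)
    then show ?thesis
      unfolding tor_rep_def by (subst uea_incl_expansion) (unfold lin_ext_mult uea.lin_ext_lin_ext, intro verma_rel_lin_ext)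
  qed
  ultimately show ?case
    unfolding verma_coords_incl by (rule verma_rel_trans)
next
  case (add u v)
  then show ?case
    using verma_rel_add[OF add] by (simp add: verma_coords_def tor_module.uea_act_add uea.lin_ext_add add_diff_add)
next
  case (scale c u)
  then show ?case
    using verma_rel_scale[OF scale, of c]
    by (simp add: verma_coords_def tor_module.uea_act_scale uea.lin_ext_scale uea_vs.scale_right_diff_distrib)
qed

section \<open>Weights of the affine monomials\<close>
definition Q1_weight :: "nat \<Rightarrow> nat \<Rightarrow> toroidal \<Rightarrow> complex" where
  "Q1_weight m n x = of_nat m * root_alpha0 x + of_nat n * root_alpha x"

text \<open>
  The negative affine root vectors have roots \<open>- (p \<alpha>\<^sub>0 + q \<alpha>\<^sub>1)\<close>; these are \<open>p\<close> and \<open>q\<close>. They come from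
  \<open>\<delta>\<^sub>1 = \<alpha>\<^sub>0 + \<alpha>\<^sub>1\<close>, and truncation by \<open>nat\<close> never takes effect on negative affine basis vectors.
\<close>
fun alpha0_coeff :: "toroidal_basis \<Rightarrow> nat" where
  "alpha0_coeff (Loop c m n) = nat (- m)"
| "alpha0_coeff _ = 0"

fun alpha_coeff :: "toroidal_basis \<Rightarrow> nat" where
  "alpha_coeff (Loop E m n) = nat (- m - 1)"
| "alpha_coeff (Loop F m n) = nat (- m + 1)"
| "alpha_coeff (Loop H m n) = nat (- m)"
| "alpha_coeff _ = 0"

lemma Q1_weight_in_Q1_plus: "Q1_weight m n \<in> Q1_plus"
  unfolding Q1_plus_def Q1_weight_def by blast

lemma Q1_weight_zero: "Q1_weight 0 0 h = 0"
  by (simp add: Q1_weight_def)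

lemma Q1_weight_add: "Q1_weight (m + m') (n + n') h = Q1_weight m n h + Q1_weight m' n' h"
  by (simp add: Q1_weight_def algebra_simps)

lemma Q1_weight_linear:
  "Q1_weight m n 0 = 0" "Q1_weight m n (x + y) = Q1_weight m n x + Q1_weight m n y"
  "Q1_weight m n (c *\<^sub>C x) = c * Q1_weight m n x"
proof -
  have "root_alpha 0 = 0" "root_delta1 0 = 0"
    "root_alpha (x + y) = root_alpha x + root_alpha y" "root_delta1 (x + y) = root_delta1 x + root_delta1 y"
    "root_alpha (c *\<^sub>C x) = c * root_alpha x" "root_delta1 (c *\<^sub>C x) = c * root_delta1 x"
    by (simp_all add: root_alpha_def root_delta1_def zero_toroidal.rep_eq plus_toroidal.rep_eq
        scaleC_toroidal.rep_eq lookup_add)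
  then show "Q1_weight m n 0 = 0" "Q1_weight m n (x + y) = Q1_weight m n x + Q1_weight m n y"
    "Q1_weight m n (c *\<^sub>C x) = c * Q1_weight m n x"
    by (simp_all add: Q1_weight_def root_alpha0_def algebra_simps)
qed

lemma cartan_lie_affine:
  assumes b: "b \<in> neg_basis \<inter> affine_basis" and h: "h \<in> cartan"
  shows "lie h (basis_vec b) = (- Q1_weight (alpha0_coeff b) (alpha_coeff b) h) *\<^sub>C basis_vec b"
  using h unfolding cartan_def
proof (induction rule: lie_vs.span_induct_alt)
  case base
  have "lie 0 (basis_vec b) = 0"
    using lie_add_left[of 0 0 "basis_vec b"] by simp
  then show ?case by (simp add: Q1_weight_linear)
next
  case (step c x y)
  obtain a m where bm: "b = Loop a m 0" "m < 0 \<or> m = 0 \<and> a = F"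
    using b by (cases b) auto
  have roots: "root_alpha x = 2 * Poly_Mapping.lookup (coords x) (Loop H 0 0)"
    "root_delta1 x = Poly_Mapping.lookup (coords x) D1"
    by (simp_all add: root_alpha_def root_delta1_def)
  have bracket: "lie (basis_vec g) (basis_vec b) = c *\<^sub>C basis_vec b"
    if "basis_bracket g b = Poly_Mapping.single b c" for g c
    unfolding lie_basis_vec that coords_inject[symmetric]
    by (simp add: of_coords_inverse scaleC_toroidal.rep_eq basis_vec.rep_eq coords_scale_single)
  have "m \<le> 0" using bm by auto
  then have m: "of_nat (nat (- m)) = (- of_int m :: complex)" by simp
  have coeff: "of_nat (alpha_coeff b) = (- of_int m + (case a of E \<Rightarrow> - 1 | F \<Rightarrow> 1 | H \<Rightarrow> 0) :: complex)"
    using bm by (cases a) (auto simp: of_nat_nat)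
  have weight: "Q1_weight (alpha0_coeff b) (alpha_coeff b) x =
      - of_int m * root_delta1 x + (case a of E \<Rightarrow> - 1 | F \<Rightarrow> 1 | H \<Rightarrow> 0) * root_alpha x"
    unfolding Q1_weight_def coeff root_alpha0_def by (simp add: bm(1) m algebra_simps)
  consider "x = h_loop 0 0" | "x = basis_vec C1" | "x = basis_vec C2" | "x = basis_vec D1" | "x = basis_vec D2"
    using step(1) by blast
  then have "lie x (basis_vec b) = (- Q1_weight (alpha0_coeff b) (alpha_coeff b) x) *\<^sub>C basis_vec b"
  proof cases
    case 1
    have "basis_bracket (Loop H 0 0) b = Poly_Mapping.single b (case a of E \<Rightarrow> 2 | F \<Rightarrow> - 2 | H \<Rightarrow> 0)"
      by (cases a) (simp_all add: bm(1) loop_coords_def)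
    then have "lie (h_loop 0 0) (basis_vec b) = (case a of E \<Rightarrow> 2 | F \<Rightarrow> - 2 | H \<Rightarrow> 0) *\<^sub>C basis_vec b"
      by (rule bracket)
    then show ?thesis
      unfolding weight roots unfolding 1 by (cases a) (simp_all add: basis_vec.rep_eq lookup_single when_def)
  next
    case 2
    then show ?thesis
      using bracket[of C1 0] unfolding weight roots by (simp add: basis_vec.rep_eq lookup_single when_def)
  next
    case 3
    then show ?thesis
      using bracket[of C2 0] unfolding weight roots by (simp add: basis_vec.rep_eq lookup_single when_def)
  next
    case 4
    then show ?thesis
      using bracket[of D1 "of_int m"] unfolding weight roots by (simp add: bm(1) basis_vec.rep_eq lookup_single when_def)
  next
    case 5
    then show ?thesis
      using bracket[of D2 0] unfolding weight roots by (simp add: bm(1) basis_vec.rep_eq lookup_single when_def)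
  qed
  then show ?case
    using step(2) by (simp add: lie_add_left lie_scaleC_left Q1_weight_linear scaleC_scaleC
        lie_vs.scale_left_diff_distrib lie_vs.scale_minus_left)
qed

lemma cartan_mult_prod_list:
  assumes "set bs \<subseteq> neg_basis \<inter> affine_basis" and h: "h \<in> cartan"
  defines "P \<equiv> \<lambda>bs. prod_list (map (\<lambda>b. uea_incl (basis_vec b)) bs)"
  shows "uea_incl h * P bs = P bs * uea_incl h -
    uea_scale (Q1_weight (sum_list (map alpha0_coeff bs)) (sum_list (map alpha_coeff bs)) h) (P bs)"
  using assms(1)
proof (induction bs)
  case Nil
  then show ?case by (simp add: P_def Q1_weight_zero)
next
  case (Cons b bs)
  let ?b = "uea_incl (basis_vec b)" and ?h = "uea_incl h"
  let ?w = "Q1_weight (alpha0_coeff b) (alpha_coeff b) h"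
  have "lie h (basis_vec b) = (- ?w) *\<^sub>C basis_vec b"
    using Cons.prems by (intro cartan_lie_affine h) simp
  then have "?h * ?b - ?b * ?h = - uea_scale ?w ?b"
    using uea_incl_lie[of h "basis_vec b"] by (simp only: uea_incl_scale uea_vs.scale_minus_left)
  then have hb: "?h * ?b = ?b * ?h - uea_scale ?w ?b"
    by (simp add: diff_eq_eq)
  have "?h * P (b # bs) = (?h * ?b) * P bs"
    by (simp add: P_def mult.assoc)
  also have "\<dots> = ?b * (?h * P bs) - uea_scale ?w (?b * P bs)"
    by (simp add: hb left_diff_distrib mult.assoc uea_scale_mult_left)
  also have "?h * P bs = P bs * ?h -
      uea_scale (Q1_weight (sum_list (map alpha0_coeff bs)) (sum_list (map alpha_coeff bs)) h) (P bs)"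
    using Cons by simp
  finally show ?case
    by (simp add: P_def right_diff_distrib mult.assoc mult_uea_scale_right Q1_weight_add
        uea_vs.scale_left_distrib)
qed

definition monomial_weight :: "toroidal_basis multiset \<Rightarrow> toroidal \<Rightarrow> complex" where
  "monomial_weight S = Q1_weight (\<Sum>b\<in>#S. alpha0_coeff b) (\<Sum>b\<in>#S. alpha_coeff b)"

lemma monomial_weight_in_Q1_plus: "monomial_weight S \<in> Q1_plus"
  by (simp add: monomial_weight_def Q1_weight_in_Q1_plus)

text \<open>
  Moving \<open>h\<close> to the right through the monomial collects the roots of its factors, and at the right
  end \<open>h\<close> acts by \<open>lam h\<close>.
\<close>
lemma cartan_mult_pbw_monomial:
  assumes S: "set_mset S \<subseteq> neg_basis \<inter> affine_basis" and h: "h \<in> cartan"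
  shows "uea_incl h * pbw_monomial S - uea_scale (lam h - monomial_weight S h) (pbw_monomial S) \<in> verma_rel lam"
proof -
  let ?l = "sorted_list_of_multiset S"
  have sums: "sum_list (map f ?l) = (\<Sum>b\<in>#S. f b)" for f :: "toroidal_basis \<Rightarrow> nat"
    by (metis mset_map mset_sorted_list_of_multiset sum_mset_sum_list)
  have "uea_incl h * pbw_monomial S = pbw_monomial S * uea_incl h - uea_scale (monomial_weight S h) (pbw_monomial S)"
    using cartan_mult_prod_list[of ?l h] S h by (simp add: pbw_monomial_def sums monomial_weight_def)
  then have "uea_incl h * pbw_monomial S - uea_scale (lam h - monomial_weight S h) (pbw_monomial S) =
      pbw_monomial S * uea_incl h - uea_scale (lam h) (pbw_monomial S)"
    by (simp add: uea_vs.scale_left_diff_distrib)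
  also have "\<dots> \<in> verma_rel lam"
    unfolding verma_rel_def using borel_cartan[OF h, of lam] by (intro uea_vs.span_base) blast
  finally show ?thesis .
qed

section \<open>Singular vectors of the Verma module\<close>
lemma verma_coset_eq:
  assumes "u - v \<in> verma_rel lam"
  shows "u +o verma_rel lam = v +o verma_rel lam"
proof -
  have sub: "u +o verma_rel lam \<subseteq> v +o verma_rel lam" if "u - v \<in> verma_rel lam" for u v
  proof
    fix x
    assume "x \<in> u +o verma_rel lam"
    then obtain r where r: "x = u + r" "r \<in> verma_rel lam" by (auto simp: elt_set_plus_def)
    then have "x = v + ((u - v) + r)" by simp
    then show "x \<in> v +o verma_rel lam"
      unfolding elt_set_plus_def using verma_rel_add[OF that r(2)] by blast
  qed
  show ?thesis
    using sub[OF assms] sub[of v u] verma_rel_uminus[OF assms] by auto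
qed

lemma weight_vector_coset:
  assumes "\<And>h. h \<in> cartan \<Longrightarrow> uea_incl h * u - uea_scale (mu h) u \<in> verma_rel lam"
  shows "u +o verma_rel lam \<in> verma_weight_space lam mu"
  using assms by (auto simp: verma_weight_space_def verma_def verma_act_coset verma_scale_coset intro!: verma_coset_eq)

lemma sum_cosets:
  "finite T \<Longrightarrow> verma_rel lam + (\<Sum>\<eta>\<in>T. g \<eta> +o verma_rel lam) = (\<Sum>\<eta>\<in>T. g \<eta>) +o verma_rel lam"
proof (induction T rule: finite_induct)
  case empty
  then show ?case by simp
next
  case (insert \<eta> T)
  have rel: "verma_rel lam + verma_rel lam = verma_rel lam"
    using verma_rel_add verma_rel_zero by (force simp: set_plus_def)
  have "verma_rel lam + (\<Sum>\<eta>\<in>insert \<eta> T. g \<eta> +o verma_rel lam) =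
      (g \<eta> +o verma_rel lam) + (verma_rel lam + (\<Sum>\<eta>\<in>T. g \<eta> +o verma_rel lam))"
    by (simp only: sum.insert[OF insert.hyps] add.left_commute)
  also have "\<dots> = (g \<eta> +o verma_rel lam) + (sum g T +o verma_rel lam)"
    by (simp only: insert.IH)
  also have "\<dots> = (\<Sum>\<eta>\<in>insert \<eta> T. g \<eta>) +o verma_rel lam"
    by (simp only: set_plus_rearrange rel sum.insert[OF insert.hyps])
  finally show ?case .
qed

theorem corollary4p2:
  fixes lam :: "toroidal \<Rightarrow> complex" and k1 :: real
  assumes "is_weight lam"
    and "lam (basis_vec C1) = complex_of_real k1" and "k1 > 0"
    and "lam (basis_vec C2) = 0"
  shows "verma_singular lam \<subseteq> verma_Q1_part lam"
proof
  fix v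
  assume v: "v \<in> verma_singular lam"
  then obtain u where u: "v = u +o verma_rel lam"
    by (auto simp: verma_singular_def verma_def)
  define w where "w = verma_coords lam u"
  have "lin (tor_act lam (Loop a r 1)) w = 0" for a r
  proof -
    have "basis_vec (Loop a r 1) = loop ((\<lambda>_. 0)(a := 1)) r 1"
      by (cases a) (simp_all add: loop_expansion lie_vs.scale_zero_left)
    then have "basis_vec (Loop a r 1) \<in> {loop x m n |x m n. n \<ge> 1}"
      by force
    then have "basis_vec (Loop a r 1) \<in> toroidal_pos"
      unfolding toroidal_pos_def by (intro lie_vs.span_base) blast
    then have "(uea_incl (basis_vec (Loop a r 1)) * u) +o verma_rel lam = verma_rel lam"
      using v by (simp add: verma_singular_def u verma_act_coset)
    moreover have "uea_incl (basis_vec (Loop a r 1)) * u \<in> (uea_incl (basis_vec (Loop a r 1)) * u) +o verma_rel lam"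
      using verma_rel_zero by (force simp: elt_set_plus_def)
    ultimately have "uea_incl (basis_vec (Loop a r 1)) * u \<in> verma_rel lam" by simp
    then have "verma_coords lam (uea_incl (basis_vec (Loop a r 1)) * u) = 0"
      by (rule verma_coords_rel[OF assms(1)])
    then show ?thesis by (simp add: verma_coords_incl tor_rep_basis w_def)
  qed
  then have affine: "set_mset S \<subseteq> affine_basis" if "S \<in> Poly_Mapping.keys w" "set_mset S \<subseteq> neg_basis" for S
    using that by (rule affine_if_degree_one_kills)
  define K where "K = {S \<in> Poly_Mapping.keys w. set_mset S \<subseteq> neg_basis}"
  define T where "T = monomial_weight ` K"
  define g where "g \<eta> = (\<Sum>S | S \<in> K \<and> monomial_weight S = \<eta>. uea_scale (Poly_Mapping.lookup w S) (pbw_monomial S))" for \<eta>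
  have K: "finite K" "\<And>S. S \<in> K \<Longrightarrow> set_mset S \<subseteq> neg_basis \<inter> affine_basis"
    using affine by (auto simp: K_def)
  have "pbw_sum w = (\<Sum>S\<in>K. uea_scale (Poly_Mapping.lookup w S) (pbw_monomial S))"
    unfolding lin_ext_def by (intro sum.mono_neutral_right) (auto simp: K_def pbw_monomial_def)
  also have "\<dots> = (\<Sum>\<eta>\<in>T. g \<eta>)"
    unfolding T_def g_def by (rule sum.image_gen[OF K(1)])
  finally have "v = (\<Sum>\<eta>\<in>T. g \<eta>) +o verma_rel lam"
    using verma_coset_eq[OF pbw_spanning[of u lam]] by (simp add: u w_def)
  also have "\<dots> = verma_rel lam + (\<Sum>\<eta>\<in>T. g \<eta> +o verma_rel lam)"
    using K(1) by (simp add: sum_cosets T_def)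
  finally have sum: "v = verma_rel lam + (\<Sum>\<eta>\<in>T. g \<eta> +o verma_rel lam)" .
  have "g \<eta> +o verma_rel lam \<in> verma_weight_space lam (\<lambda>h. lam h - \<eta> h)" for \<eta>
  proof (rule weight_vector_coset)
    fix h
    assume h: "h \<in> cartan"
    let ?K = "{S \<in> K. monomial_weight S = \<eta>}"
    have "uea_incl h * g \<eta> - uea_scale (lam h - \<eta> h) (g \<eta>) =
      (\<Sum>S\<in>?K. uea_scale (Poly_Mapping.lookup w S)
        (uea_incl h * pbw_monomial S - uea_scale (lam h - monomial_weight S h) (pbw_monomial S)))"
      by (simp add: g_def sum_distrib_left mult_uea_scale_right uea_vs.scale_sum_right mult.commute
          uea_vs.scale_right_diff_distrib flip: sum_subtractf)
    also have "\<dots> \<in> verma_rel lam"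
      using cartan_mult_pbw_monomial[OF K(2) h] unfolding verma_rel_def
      by (intro uea_vs.span_sum uea_vs.span_scale) auto
    finally show "uea_incl h * g \<eta> - uea_scale (lam h - \<eta> h) (g \<eta>) \<in> verma_rel lam" .
  qed
  moreover have "finite T" "T \<subseteq> Q1_plus"
    using K(1) by (auto simp: T_def monomial_weight_in_Q1_plus)
  ultimately show "v \<in> verma_Q1_part lam"
    unfolding verma_Q1_part_def using sum by blast
qed

end
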